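(* Let $A$ be the operator in $H$ associated with a sesquilinear form $a\colon V\times V\to\mathbb{C}$ which is continuous ($|a(u,v)|\le C\|u\|\|v\|$) and strongly accretive ($\operatorname{Re}a(u,u)\ge c\|u\|^2$ for some $c>0$). If $A$ is quasi-symmetric, i.e. there are constants $\alpha>-1$ and $\beta,M\ge0$ with $$\operatorname{Re}\bigl((A^* )^{-1}(Au+Mu),u\bigr)\ge\alpha|u|^2\quad\text{and}\quad|(A^* )^{-1}Au|\le\beta|u|\quad\text{for all }u\in D(A),$$ then $A$ is a Kato operator, i.e. $D(A^{1/2})=V$ with equivalent norms.
   Context: $(H,(\cdot,\cdot),|\cdot|)$ is a complex Hilbert space and $(V,\|\cdot\|)$ a complex Banach space densely (and continuously) embedded into $H$. The operator $A$ associated with $a$: $u\in D(A)$ iff $u\in V$ and there is (a unique) $Au\in H$ with $(Au,\varphi)=a(u,\varphi)$ for all $\varphi\in V$. $A$ is densely defined, $-A$ generates an analytic $C_0$-semigroup, the spectrum of $A$ lies in the open right half-plane, and so the fractional power $A^{1/2}$ is defined; $D(A^{1/2})$ carries the norm $|A^{1/2}u|$. $A^*$ is the Hilbert space adjoint; $(A^* )^{-1}=(A^{-1})^*$ is bounded on $H$. *)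

theory Defs
  imports "HOL-Analysis.Analysis"
begin

class complex_normed_vector = real_normed_vector +
  fixes scaleC :: "complex \<Rightarrow> 'a \<Rightarrow> 'a"  (infixr "*\<^sub>C" 75)
  assumes scaleC_add_right: "c *\<^sub>C (x + y) = c *\<^sub>C x + c *\<^sub>C y"
    and scaleC_add_left: "(c + d) *\<^sub>C x = c *\<^sub>C x + d *\<^sub>C x"
    and scaleC_scaleC: "c *\<^sub>C d *\<^sub>C x = (c * d) *\<^sub>C x"
    and scaleC_of_real: "complex_of_real r *\<^sub>C x = r *\<^sub>R x"
    and norm_scaleC: "norm (c *\<^sub>C x) = cmod c * norm x"

class complex_banach = complex_normed_vector + complete_space
begin
subclass banach ..
end

text \<open>The complex inner product is linear in its first argument. The underlying real inner product
  is its real part, so positive definiteness and the relation to the norm are inherited from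
  \<^class>\<open>real_inner\<close>.\<close>

class complex_inner = complex_normed_vector + real_inner +
  fixes cinner :: "'a \<Rightarrow> 'a \<Rightarrow> complex"
  assumes cinner_commute: "cinner x y = cnj (cinner y x)"
    and cinner_add_left: "cinner (x + y) z = cinner x z + cinner y z"
    and cinner_scaleC_left: "cinner (c *\<^sub>C x) y = c * cinner x y"
    and inner_eq_Re_cinner: "inner x y = Re (cinner x y)"

class complex_hilbert = complex_inner + complete_space
begin
subclass complex_banach ..
end

instantiation complex :: complex_hilbert
begin

definition scaleC_complex :: "complex \<Rightarrow> complex \<Rightarrow> complex"
  where "scaleC_complex c x = c * x"

definition cinner_complex :: "complex \<Rightarrow> complex \<Rightarrow> complex"
  where "cinner_complex x y = x * cnj y"

instance
  by standard
    (auto simp: scaleC_complex_def cinner_complex_def algebra_simps scaleR_conv_of_real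
      norm_mult inner_complex_def)

end

lemma cinner_self: "cinner x x = complex_of_real ((norm x)\<^sup>2)"
proof (rule complex_eqI)
  show "Re (cinner x x) = Re (complex_of_real ((norm x)\<^sup>2))"
    by (simp flip: inner_eq_Re_cinner add: power2_norm_eq_inner)
  have "Im (cinner x x) = - Im (cinner x x)"
    by (metis cinner_commute cnj.simps(2))
  then show "Im (cinner x x) = Im (complex_of_real ((norm x)\<^sup>2))"
    by simp
qed

definition dense_embedding :: "('v::complex_normed_vector \<Rightarrow> 'h::complex_normed_vector) \<Rightarrow> bool"
  where "dense_embedding j \<longleftrightarrow>
    bounded_linear j \<and> (\<forall>c v. j (c *\<^sub>C v) = c *\<^sub>C j v) \<and> inj j \<and> closure (range j) = UNIV"

definition sesquilinear :: "('v::complex_normed_vector \<Rightarrow> 'v \<Rightarrow> complex) \<Rightarrow> bool"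
  where "sesquilinear a \<longleftrightarrow>
    (\<forall>u v w. a (u + v) w = a u w + a v w) \<and>
    (\<forall>c u v. a (c *\<^sub>C u) v = c * a u v) \<and>
    (\<forall>u v w. a u (v + w) = a u v + a u w) \<and>
    (\<forall>c u v. a u (c *\<^sub>C v) = cnj c * a u v)"

definition continuous_form :: "('v::complex_normed_vector \<Rightarrow> 'v \<Rightarrow> complex) \<Rightarrow> bool"
  where "continuous_form a \<longleftrightarrow> (\<exists>C. \<forall>u v. cmod (a u v) \<le> C * norm u * norm v)"

definition strongly_accretive :: "('v::complex_normed_vector \<Rightarrow> 'v \<Rightarrow> complex) \<Rightarrow> bool"
  where "strongly_accretive a \<longleftrightarrow> (\<exists>c>0. \<forall>u. Re (a u u) \<ge> c * (norm u)\<^sup>2)"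

text \<open>An unbounded operator is given by its domain \<open>D\<close> and a function \<open>T\<close> whose values outside \<open>D\<close>
  are irrelevant. The space \<open>V\<close> is identified with its image under the embedding \<open>j\<close>.\<close>

definition form_dom ::
  "('v::complex_normed_vector \<Rightarrow> 'h::complex_inner) \<Rightarrow> ('v \<Rightarrow> 'v \<Rightarrow> complex) \<Rightarrow> 'h set"
  where "form_dom j a = {j u | u. \<exists>f. \<forall>\<phi>. cinner f (j \<phi>) = a u \<phi>}"

definition form_op ::
  "('v::complex_normed_vector \<Rightarrow> 'h::complex_inner) \<Rightarrow> ('v \<Rightarrow> 'v \<Rightarrow> complex) \<Rightarrow> 'h \<Rightarrow> 'h"
  where "form_op j a x = (THE f. \<exists>u. x = j u \<and> (\<forall>\<phi>. cinner f (j \<phi>) = a u \<phi>))"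

definition adjoint_dom :: "'h::complex_inner set \<Rightarrow> ('h \<Rightarrow> 'h) \<Rightarrow> 'h set"
  where "adjoint_dom D T = {w. \<exists>g. \<forall>u\<in>D. cinner (T u) w = cinner u g}"

definition adjoint_op :: "'h::complex_inner set \<Rightarrow> ('h \<Rightarrow> 'h) \<Rightarrow> 'h \<Rightarrow> 'h"
  where "adjoint_op D T w = (THE g. \<forall>u\<in>D. cinner (T u) w = cinner u g)"

definition adjoint_inv :: "'h::complex_inner set \<Rightarrow> ('h \<Rightarrow> 'h) \<Rightarrow> 'h \<Rightarrow> 'h"
  where "adjoint_inv D T = the_inv_into (adjoint_dom D T) (adjoint_op D T)"

definition quasi_symmetric :: "'h::complex_inner set \<Rightarrow> ('h \<Rightarrow> 'h) \<Rightarrow> bool"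
  where "quasi_symmetric D T \<longleftrightarrow>
    (\<exists>\<alpha> \<beta> M :: real. \<alpha> > -1 \<and> \<beta> \<ge> 0 \<and> M \<ge> 0 \<and>
      (\<forall>u\<in>D. Re (cinner (adjoint_inv D T (T u + M *\<^sub>R u)) u) \<ge> \<alpha> * (norm u)\<^sup>2 \<and>
             norm (adjoint_inv D T (T u)) \<le> \<beta> * norm u))"

text \<open>Balakrishnan's formula
  \<open>T\<^sup>-\<^sup>1\<^sup>/\<^sup>2 x = 1/\<pi> \<integral>\<^sub>0\<^sup>\<infinity> t\<^sup>-\<^sup>1\<^sup>/\<^sup>2 (t + T)\<^sup>-\<^sup>1 x dt\<close>; the square root of \<open>T\<close> is the inverse of
  this operator, so that its domain is the range of \<open>T\<^sup>-\<^sup>1\<^sup>/\<^sup>2\<close>. The gauge integral is used because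
  the Bochner integral of the library is confined to separable spaces.\<close>

definition inv_sqrt_op :: "'h::complex_banach set \<Rightarrow> ('h \<Rightarrow> 'h) \<Rightarrow> 'h \<Rightarrow> 'h"
  where "inv_sqrt_op D T x =
    (1 / pi) *\<^sub>R integral {0<..} (\<lambda>t. t powr (-1/2) *\<^sub>R the_inv_into D (\<lambda>u. t *\<^sub>R u + T u) x)"

definition sqrt_dom :: "'h::complex_banach set \<Rightarrow> ('h \<Rightarrow> 'h) \<Rightarrow> 'h set"
  where "sqrt_dom D T = range (inv_sqrt_op D T)"

definition sqrt_op :: "'h::complex_banach set \<Rightarrow> ('h \<Rightarrow> 'h) \<Rightarrow> 'h \<Rightarrow> 'h"
  where "sqrt_op D T = the_inv (inv_sqrt_op D T)"

definition kato_operator ::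
  "('v::complex_normed_vector \<Rightarrow> 'h::complex_banach) \<Rightarrow> 'h set \<Rightarrow> ('h \<Rightarrow> 'h) \<Rightarrow> bool"
  where "kato_operator j D T \<longleftrightarrow>
    sqrt_dom D T = range j \<and>
    (\<exists>c1>0. \<exists>c2>0. \<forall>v. c1 * norm v \<le> norm (sqrt_op D T (j v)) \<and>
                      norm (sqrt_op D T (j v)) \<le> c2 * norm v)"

end

theory Submission
  imports Defs
begin

text \<open>Everything is done for the real form \<open>b = Re a\<close>; put \<open>R(t) = (t + A)\<^sup>-\<^sup>1\<close>.
  The two conditions say that \<open>S A\<^sup>-\<^sup>1\<close> is bounded and strictly accretive, where \<open>S\<close> is the
  self-adjoint operator of \<open>s(u,v) = b(u,v) + b(v,u) + M (u,v)\<close>, whose form norm is that of \<open>V\<close>.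
  So \<open>D(S) \<subseteq> D(A)\<close>, and hence \<open>D(S) \<subseteq> D(A\<^sup>*)\<close> as \<open>A\<^sup>* = S - A - M\<close> there. It follows that
  \<open>|A R(t) v|\<close> and \<open>|A\<^sup>* R(t)\<^sup>* v|\<close> are dominated by \<open>|S (t + S)\<^sup>-\<^sup>1 v|\<close>, whose square has integral at
  most \<open>s(v,v)\<close>. On the other hand \<open>\<integral> t |A R(t)\<^sup>2 x|\<^sup>2 dt \<le> |x|\<^sup>2 / 2\<close> for every accretive \<open>A\<close>, because
  \<open>|t R(t) x|\<^sup>2\<close> is increasing in \<open>t\<close> and bounded by \<open>|x|\<^sup>2\<close>. The Cauchy--Schwarz inequality applied to
  \<open>a(A\<^sup>-\<^sup>1\<^sup>/\<^sup>2 x, \<phi>) = (8/\<pi>) \<integral> t\<^sup>1\<^sup>/\<^sup>2 (A R(t)\<^sup>2 x, A\<^sup>* R(t)\<^sup>* \<phi>) dt\<close> then shows that \<open>A\<^sup>-\<^sup>1\<^sup>/\<^sup>2\<close> maps \<open>H\<close>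
  boundedly into \<open>V\<close>, and likewise for \<open>A\<^sup>*\<close>. By duality and \<open>A\<^sup>-\<^sup>1\<^sup>/\<^sup>2 A\<^sup>-\<^sup>1\<^sup>/\<^sup>2 = A\<^sup>-\<^sup>1\<close> this yields the
  lower bound and, by density of \<open>D(A)\<close> in \<open>V\<close>, surjectivity onto \<open>V\<close>.\<close>

subsection \<open>Dominated improper gauge integrals of Banach space valued functions\<close>

text \<open>For a general form the conclusion fails, so the hypothesis must enter at a definite
  point. Of the two factors in the Cauchy--Schwarz step, the one with \<open>R(t)^2 x\<close> is
  controlled for every accretive A. The factor with \<phi> has to be bounded by the norm of V, and
  this is all that the domain inclusions are for: they allow comparison with a self-adjoint
  operator, for which the square integral is computed exactly by a primitive. Both A and its adjoint
  have to be treated, since the bound for A uses the estimate of the adjoint factor, and the lower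
  bound for A uses the upper bound for the adjoint. The real form suffices because quasi-symmetry
  speaks only of norms and real parts, and because the real resolvents coincide with the complex
  ones. That the square root integral squares to the inverse of A is not read off a double integral.
  It is obtained by shifting A to A + \<mu> and showing that a suitable inner product is constant in
  \<mu>.\<close>

lemma integrable_on_of_integrable_approximation:
  fixes f :: "real \<Rightarrow> 'a::banach"
  assumes F: "\<And>n::nat. F n integrable_on cbox a b"
    and G: "\<And>n. G n integrable_on cbox a b"
    and le: "\<And>n x. x \<in> cbox a b \<Longrightarrow> norm (f x - F n x) \<le> G n x"
    and lim: "\<And>e::real. e > 0 \<Longrightarrow> \<exists>n. integral (cbox a b) (G n) < e"
  shows "f integrable_on cbox a b"
proof (subst integrable_Cauchy, intro allI impI)
  fix e :: real
  assume "e > 0"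
  then obtain n where n: "integral (cbox a b) (G n) < e / 8"
    using lim[of "e / 8"] by auto
  have "(G n has_integral integral (cbox a b) (G n)) (cbox a b)"
    using G by (rule integrable_integral)
  then have "\<exists>d. gauge d \<and> (\<forall>D. D tagged_division_of cbox a b \<longrightarrow> d fine D \<longrightarrow>
       norm ((\<Sum>(x,K)\<in>D. measure lborel K *\<^sub>R G n x) - integral (cbox a b) (G n)) < e / 8)"
    by (rule has_integralD[of _ _ _ _ "e / 8"]) (use \<open>e > 0\<close> in auto)
  then obtain d1 where d1: "gauge d1"
    "\<And>D. D tagged_division_of cbox a b \<Longrightarrow> d1 fine D \<Longrightarrow>
       norm ((\<Sum>(x,K)\<in>D. measure lborel K *\<^sub>R G n x) - integral (cbox a b) (G n)) < e / 8"
    by blast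
  obtain d2 where d2: "gauge d2"
    "\<And>D1 D2. D1 tagged_division_of cbox a b \<and> d2 fine D1 \<and> D2 tagged_division_of cbox a b \<and> d2 fine D2 \<Longrightarrow>
       norm ((\<Sum>(x,K)\<in>D1. measure lborel K *\<^sub>R F n x) - (\<Sum>(x,K)\<in>D2. measure lborel K *\<^sub>R F n x)) < e / 4"
    using F[of n, unfolded integrable_Cauchy, rule_format, of "e / 4"] \<open>e > 0\<close> by auto
  \<comment> \<open>Riemann sums of \<open>f\<close> and \<open>F n\<close> differ by at most the
    Riemann sum of \<open>G n\<close>, which lies within e/8 of an integral below e/8. Two such
    errors and the Cauchy bound for \<open>F n\<close> total 3e/4.\<close>
  have close: "norm ((\<Sum>(x,K)\<in>D. measure lborel K *\<^sub>R f x) - (\<Sum>(x,K)\<in>D. measure lborel K *\<^sub>R F n x)) < e / 4"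
    if D: "D tagged_division_of cbox a b" and fine: "d1 fine D" for D
  proof -
    have "norm ((\<Sum>(x,K)\<in>D. measure lborel K *\<^sub>R f x) - (\<Sum>(x,K)\<in>D. measure lborel K *\<^sub>R F n x))
        = norm (\<Sum>(x,K)\<in>D. measure lborel K *\<^sub>R (f x - F n x))"
      by (simp add: sum_subtractf[symmetric] case_prod_beta scaleR_diff_right)
    also have "\<dots> \<le> (\<Sum>(x,K)\<in>D. measure lborel K *\<^sub>R G n x)"
      using D by (intro sum_norm_le) (auto intro!: mult_left_mono le dest: tag_in_interval simp: case_prod_beta)
    also have "\<dots> < e / 4"
      using d1(2)[OF D fine, unfolded real_norm_def] n by linarith
    finally show ?thesis .
  qed
  show "\<exists>\<gamma>. gauge \<gamma> \<and>
          (\<forall>\<D>1 \<D>2. \<D>1 tagged_division_of (cbox a b) \<and> \<gamma> fine \<D>1 \<and>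
            \<D>2 tagged_division_of (cbox a b) \<and> \<gamma> fine \<D>2 \<longrightarrow>
            norm ((\<Sum>(x,K)\<in>\<D>1. measure lborel K *\<^sub>R f x) - (\<Sum>(x,K)\<in>\<D>2. measure lborel K *\<^sub>R f x)) < e)"
  proof (intro exI[of _ "\<lambda>x. d1 x \<inter> d2 x"] conjI allI impI gauge_Int d1 d2, elim conjE)
    fix D1 D2
    assume D: "D1 tagged_division_of cbox a b" "D2 tagged_division_of cbox a b"
      and fine: "(\<lambda>x. d1 x \<inter> d2 x) fine D1" "(\<lambda>x. d1 x \<inter> d2 x) fine D2"
    let ?S = "\<lambda>h D. \<Sum>(x,K)\<in>D. measure lborel K *\<^sub>R h x"
    have "norm (?S f D1 - ?S f D2)
        = norm ((?S f D1 - ?S (F n) D1) + (?S (F n) D1 - ?S (F n) D2) - (?S f D2 - ?S (F n) D2))"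
      by simp
    also have "\<dots> \<le> norm (?S f D1 - ?S (F n) D1) + norm (?S (F n) D1 - ?S (F n) D2)
        + norm (?S f D2 - ?S (F n) D2)"
      by (meson add_mono norm_triangle_ineq norm_triangle_ineq4 order_refl order_trans)
    also have "\<dots> < e / 4 + e / 4 + e / 4"
      using close[OF D(1)] close[OF D(2)] d2(2)[of D1 D2] D fine
      by (intro add_strict_mono) (auto simp: fine_Int)
    finally show "norm (?S f D1 - ?S f D2) < e" using \<open>e > 0\<close> by simp
  qed
qed

text \<open>On each compact interval \<open>K n\<close> continuity gives integrability, and the
  remainder is dominated by \<open>r n\<close>, that is \<open>g\<close> cut off outside
  \<open>K n\<close>. Real dominated convergence makes the integral of \<open>r n\<close> tend to 0,
  which is the smallness needed for integrability near 0 and for the limit of the truncated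
  integrals alike.\<close>

lemma
  fixes f :: "real \<Rightarrow> 'a::banach"
  assumes f: "continuous_on {0<..} f" and g: "g integrable_on {0<..}"
    and le: "\<And>t. t > 0 \<Longrightarrow> norm (f t) \<le> g t"
  shows integrable_on_greaterThan_dominated: "f integrable_on {0<..}"
    and integral_greaterThan_dominated_LIMSEQ:
      "(\<lambda>n. integral {1 / real (Suc n)..real (Suc n)} f) \<longlonglongrightarrow> integral {0<..} f"
proof -
  define K where "K n = {1 / real (Suc n)..real (Suc n)}" for n
  define r where "r n t = (if t \<in> K n then 0 else g t)" for n t
  have Kpos: "K n \<subseteq> {0<..}" for n
    by (auto simp: K_def intro: less_le_trans[rotated])
  have g0: "0 \<le> g t" if "t > 0" for t
    using le[OF that] norm_ge_zero order_trans by blast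
  have absg: "g absolutely_integrable_on {0<..}"
    using g g0 by (intro nonnegative_absolutely_integrable_1) auto
  have "g absolutely_integrable_on K n" for n
    by (rule set_integrable_subset[OF absg]) (use Kpos in \<open>auto simp: K_def\<close>)
  then have gK: "g integrable_on K n" for n
    using set_lebesgue_integral_eq_integral(1) by blast
  have "g absolutely_integrable_on ({0<..} - K n)" for n
    by (rule set_integrable_subset[OF absg]) (auto simp: K_def)
  then have "g integrable_on ({0<..} - K n)" for n
    using set_lebesgue_integral_eq_integral(1) by blast
  moreover have "(\<lambda>t. if t \<in> {0<..} then r n t else 0) = (\<lambda>t. if t \<in> {0<..} - K n then g t else 0)" for n
    by (auto simp: r_def)
  ultimately have rint: "r n integrable_on {0<..}" for n
    using integrable_restrict_UNIV[of "{0<..}" "r n"] integrable_restrict_UNIV[of "{0<..} - K n" g] by simp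
  have r0: "r n t \<ge> 0" if "t > 0" for n t
    using g0[OF that] by (auto simp: r_def)
  have absr: "r n absolutely_integrable_on {0<..}" for n
    using rint r0 by (intro nonnegative_absolutely_integrable_1) auto
  have rsub: "r n integrable_on (cbox a b \<inter> {0<..})" for n a b
  proof -
    have "r n absolutely_integrable_on (cbox a b \<inter> {0<..})"
      by (rule set_integrable_subset[OF absr]) auto
    then show ?thesis
      using set_lebesgue_integral_eq_integral(1) by blast
  qed
  have rsub_le: "integral (cbox a b \<inter> {0<..}) (r n) \<le> integral {0<..} (r n)" for n a b
    by (rule integral_subset_le) (use rint rsub r0 in auto)
  have rlim: "(\<lambda>n. integral {0<..} (r n)) \<longlonglongrightarrow> integral {0<..} (\<lambda>t::real. 0)"
  proof (rule dominated_convergence(2)[of r "{0<..}" g "\<lambda>t. 0"])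
    fix t :: real
    assume t: "t \<in> {0<..}"
    obtain N where N: "real N > max t (1 / t)" using reals_Archimedean2 by blast
    have "r n t = 0" if "n \<ge> N" for n
    proof -
      have "real (Suc n) > max t (1 / t)" using N that by simp
      then have "t \<in> K n" using t by (auto simp: K_def field_simps)
      then show ?thesis by (simp add: r_def)
    qed
    then show "(\<lambda>n. r n t) \<longlonglongrightarrow> 0"
      by (intro tendsto_eventually) (auto simp: eventually_sequentially)
  qed (use g0 g rint in \<open>auto simp: r_def\<close>)
  then have rlim: "(\<lambda>n. integral {0<..} (r n)) \<longlonglongrightarrow> 0" by simp
  have rpos: "integral {0<..} (r n) \<ge> 0" for n
    using r0 by (intro integral_nonneg rint) auto
  define F where "F n t = (if t \<in> K n then f t else 0)" for n t
  have fK: "f integrable_on K n" for n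
    unfolding K_def by (intro integrable_continuous_real continuous_on_subset[OF f])
      (auto intro: less_le_trans[rotated])
  have FI: "F n integrable_on cbox a b" for n a b
  proof -
    have "K n \<inter> cbox a b = {max (1 / real (Suc n)) a..min (real (Suc n)) b}"
      by (auto simp: K_def)
    moreover have "f integrable_on {max (1 / real (Suc n)) a..min (real (Suc n)) b}"
      by (intro integrable_continuous_real continuous_on_subset[OF f])
        (auto intro: less_le_trans[rotated])
    ultimately show ?thesis
      unfolding F_def by (subst integrable_restrict_Int) simp
  qed
  define f' where "f' t = (if t \<in> {0<..} then f t else 0)" for t
  have f'F: "norm (f' t - F n t) \<le> (if t \<in> {0<..} then r n t else 0)" for n t
    using le[of t] g0[of t] Kpos[of n] by (auto simp: f'_def F_def r_def)
  have f'I: "f' integrable_on cbox a b" for a b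
  proof (rule integrable_on_of_integrable_approximation)
    show "F n integrable_on cbox a b" for n by (rule FI)
    show "(\<lambda>t. if t \<in> {0<..} then r n t else 0) integrable_on cbox a b" for n
      using rsub[of n a b] by (subst integrable_restrict_Int) (simp add: Int_commute)
    show "norm (f' x - F n x) \<le> (if x \<in> {0<..} then r n x else 0)" for n x by (rule f'F)
    fix e :: real assume "e > 0"
    then obtain n where "integral {0<..} (r n) < e"
      using rlim rpos by (metis (mono_tags, lifting) eventually_sequentially order_tendstoD(2) order_refl)
    then have "integral (cbox a b \<inter> {0<..}) (r n) < e"
      using rsub_le[of a b n] by linarith
    then show "\<exists>n. integral (cbox a b) (\<lambda>t. if t \<in> {0<..} then r n t else 0) < e"
      by (intro exI[of _ n]) (simp only: integral_restrict_Int Int_commute)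
  qed
  \<comment> \<open>One tail bound for all intervals containing \<open>K n\<close>: it gives both
    the Cauchy property of the truncations and the convergence of integrals over growing
    intervals.\<close>
  have diff: "norm (integral (cbox a b) f' - integral (K n) f) \<le> integral {0<..} (r n)"
    if "K n \<subseteq> cbox a b" for a b n
  proof -
    have "K n \<inter> cbox a b = K n" using that by blast
    then have eq: "integral (K n) f = integral (cbox a b) (F n)"
      unfolding F_def by (subst integral_restrict_Int) simp
    have "norm (integral (cbox a b) (\<lambda>t. f' t - F n t))
        \<le> integral (cbox a b) (\<lambda>t. if t \<in> {0<..} then r n t else 0)"
    proof (rule integral_norm_bound_integral)
      show "(\<lambda>t. if t \<in> {0<..} then r n t else 0) integrable_on cbox a b"
        using rsub[of n a b] by (subst integrable_restrict_Int) (simp add: Int_commute)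
    qed (use f'F f'I FI in \<open>auto intro: integrable_diff\<close>)
    also have "\<dots> \<le> integral {0<..} (r n)"
      using rsub_le[of a b n] by (simp only: integral_restrict_Int Int_commute)
    finally show ?thesis
      using f'I FI eq by (simp add: integral_diff)
  qed
  have "Cauchy (\<lambda>n. integral (K n) f)"
  proof (rule metric_CauchyI)
    fix e :: real assume "e > 0"
    then obtain N where N: "\<And>n. n \<ge> N \<Longrightarrow> integral {0<..} (r n) < e / 2"
      using rlim by (metis (mono_tags, lifting) eventually_sequentially order_tendstoD(2) half_gt_zero)
    show "\<exists>M. \<forall>m\<ge>M. \<forall>n\<ge>M. dist (integral (K m) f) (integral (K n) f) < e"
    proof (intro exI[of _ N] allI impI)
      fix m n assume mn: "m \<ge> N" "n \<ge> N"
      let ?b = "real (Suc (max m n))"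
      have sub: "K m \<subseteq> cbox 0 ?b" "K n \<subseteq> cbox 0 ?b"
        using Kpos[of m] Kpos[of n] by (force simp: K_def)+
      have "dist (integral (K m) f) (integral (K n) f)
          \<le> dist (integral (cbox 0 ?b) f') (integral (K m) f) + dist (integral (cbox 0 ?b) f') (integral (K n) f)"
        by (rule dist_triangle3)
      also have "\<dots> < e"
        using diff[OF sub(1)] diff[OF sub(2)] N[OF mn(1)] N[OF mn(2)] unfolding dist_norm by linarith
      finally show "dist (integral (K m) f) (integral (K n) f) < e" .
    qed
  qed
  then obtain I where I: "(\<lambda>n. integral (K n) f) \<longlonglongrightarrow> I"
    using Cauchy_convergent convergent_def by blast
  have "(f has_integral I) {0<..}"
    unfolding has_integral_alt'
  proof (intro conjI allI impI)
    show "(\<lambda>x. if x \<in> {0<..} then f x else 0) integrable_on cbox a b" for a b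
      using f'I unfolding f'_def .
    fix e :: real assume "e > 0"
    then have "eventually (\<lambda>n. integral {0<..} (r n) < e / 2) sequentially"
      "eventually (\<lambda>n. dist (integral (K n) f) I < e / 2) sequentially"
      using order_tendstoD(2)[OF rlim, of "e / 2"] tendstoD[OF I, of "e / 2"] by auto
    then obtain n where n: "integral {0<..} (r n) < e / 2" "dist (integral (K n) f) I < e / 2"
      using eventually_happens[OF eventually_conj] by fastforce
    show "\<exists>B>0. \<forall>a b. ball 0 B \<subseteq> cbox a b \<longrightarrow>
            norm (integral (cbox a b) (\<lambda>x. if x \<in> {0<..} then f x else 0) - I) < e"
    proof (intro exI[of _ "real (Suc n) + 1"] conjI allI impI)
      fix a b :: real
      assume "ball 0 (real (Suc n) + 1) \<subseteq> cbox a b"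
      moreover have "K n \<subseteq> ball 0 (real (Suc n) + 1)"
        using Kpos[of n] by (auto simp: K_def)
      ultimately have "norm (integral (cbox a b) f' - integral (K n) f) < e / 2"
        using diff[of n a b] n(1) by fastforce
      then have "norm (integral (cbox a b) f' - I) < e"
        using n(2) norm_triangle_half_l[of "integral (cbox a b) f'" "integral (K n) f" e I]
        by (simp add: dist_norm norm_minus_commute)
      then show "norm (integral (cbox a b) (\<lambda>x. if x \<in> {0<..} then f x else 0) - I) < e"
        unfolding f'_def .
    qed simp
  qed
  then show "f integrable_on {0<..}"
    "(\<lambda>n. integral {1 / real (Suc n)..real (Suc n)} f) \<longlonglongrightarrow> integral {0<..} f"
    using I by (auto simp: K_def integral_unique has_integral_integrable)
qed

text \<open>The substitution t = \<mu> s^2 leads to the arctangent primitive. This scalar case of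
  Balakrishnan's formula supplies the dominating functions for the operator integrals and the
  leading term of \<open>F \<mu>\<close> for large \<mu>.\<close>

lemma integral_inverse_sqrt_over_shift:
  fixes \<mu> :: real
  assumes "\<mu> > 0"
  shows "((\<lambda>t. t powr (-1/2) / (t + \<mu>)) has_integral pi / sqrt \<mu>) {0<..}"
proof -
  let ?f = "\<lambda>t. t powr (-1/2) / (t + \<mu>)"
  let ?F = "\<lambda>t. 2 / sqrt \<mu> * arctan (sqrt (t / \<mu>))"
  have D: "DERIV ?F t :> ?f t" if "t > 0" for t
  proof -
    have p: "t powr (-1/2) = 1 / sqrt t"
      using that powr_minus[of t "1/2"] powr_half_sqrt[of t] by (simp add: inverse_eq_divide)
    have s: "sqrt t * sqrt t = t" "sqrt \<mu> * sqrt \<mu> = \<mu>" using that assms by auto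
    have "DERIV ?F t :> 2 / sqrt \<mu> * (inverse (1 + (sqrt (t / \<mu>))\<^sup>2) * (inverse (sqrt (t / \<mu>)) / 2 * (1 / \<mu>)))"
    proof -
      have "0 < t / \<mu>" using that assms by simp
      then show ?thesis
        using assms s by (auto intro!: derivative_eq_intros simp: divide_simps simp del: zero_less_divide_iff)
    qed
    moreover have "2 / sqrt \<mu> * (inverse (1 + (sqrt (t / \<mu>))\<^sup>2) * (inverse (sqrt (t / \<mu>)) / 2 * (1 / \<mu>))) = ?f t"
      unfolding p using that assms s
      by (simp add: real_sqrt_divide field_simps)
        (subst frac_eq_eq; use that assms in \<open>simp add: algebra_simps add_pos_pos less_imp_neq[symmetric]\<close>)
    ultimately show ?thesis by simp
  qed
  have C: "isCont ?f t" if "t > 0" for t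
    using that assms by (auto intro!: continuous_intros)
  have "((\<lambda>t. ?F t) \<longlongrightarrow> ?F 0) (at_right 0)"
    by (intro tendsto_intros) (use assms in auto)
  then have L0: "((?F \<circ> real_of_ereal) \<longlongrightarrow> 0) (at_right 0)"
    by (simp add: ereal_tendsto_simps zero_ereal_def)
  have "filterlim (\<lambda>t::real. 1 / \<mu> * t) at_top at_top"
    by (rule filterlim_tendsto_pos_mult_at_top[OF tendsto_const _ filterlim_ident]) (use assms in simp)
  then have "filterlim (\<lambda>t. sqrt (t / \<mu>)) at_top at_top"
    using filterlim_compose[OF sqrt_at_top] by simp
  then have "(?F \<longlongrightarrow> 2 / sqrt \<mu> * (pi / 2)) at_top"
    by (intro tendsto_mult tendsto_const filterlim_compose[OF tendsto_arctan_at_top])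
  then have Linf: "((?F \<circ> real_of_ereal) \<longlongrightarrow> pi / sqrt \<mu>) (at_left \<infinity>)"
    by (simp add: ereal_tendsto_simps)
  have e: "einterval 0 \<infinity> = {0<..}"
    by (auto simp: einterval_def)
  note FTC = interval_integral_FTC_nonneg[of 0 \<infinity> ?F ?f, OF _ _ _ _ L0 Linf]
  have si: "set_integrable lborel (einterval 0 \<infinity>) ?f"
    by (rule FTC) (use D C assms in auto)
  have "(LBINT t=0..\<infinity>. ?f t) = pi / sqrt \<mu> - 0"
    by (rule FTC) (use D C assms in auto)
  then show ?thesis
    using set_borel_integral_eq_integral[OF si] unfolding e
    by (simp add: interval_lebesgue_integral_def e has_integral_iff)
qed

subsection \<open>Lax--Milgram\<close>

text \<open>Existence by minimising \<open>s v v / 2 - l v\<close> over \<open>W\<close>. Only a subspace on which \<open>l\<close> is bounded is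
  required, so no extension of \<open>l\<close> to the closure is needed.\<close>

lemma riesz_representation_subspace:
  fixes s :: "'v::banach \<Rightarrow> 'v \<Rightarrow> real"
  assumes s: "bounded_bilinear s" and sym: "\<And>u v. s u v = s v u"
    and c: "c > 0" "\<And>u. c * (norm u)\<^sup>2 \<le> s u u"
    and W: "subspace W"
    and l: "\<And>u v. u \<in> W \<Longrightarrow> v \<in> W \<Longrightarrow> l (u + v) = l u + l v"
      "\<And>r u. u \<in> W \<Longrightarrow> l (r *\<^sub>R u) = r * l u" "\<And>u. u \<in> W \<Longrightarrow> \<bar>l u\<bar> \<le> K * norm u"
  obtains u where "u \<in> closure W" "\<And>v. v \<in> W \<Longrightarrow> s u v = l v"
proof -
  interpret s: bounded_bilinear s by (rule s)
  define J where "J v = s v v / 2 - l v" for v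
  have lower: "J v \<ge> - (K\<^sup>2 / (2 * c))" if "v \<in> W" for v
  proof -
    have "0 \<le> (c * norm v - K)\<^sup>2 / (2 * c)" using c(1) by simp
    also have "\<dots> = c * (norm v)\<^sup>2 / 2 - K * norm v + K\<^sup>2 / (2 * c)"
      using c(1) by (simp add: power2_diff field_simps power2_eq_square)
    finally show ?thesis
      using c(2)[of v] l(3)[OF that] unfolding J_def by linarith
  qed
  define m where "m = Inf (J ` W)"
  have bdd: "bdd_below (J ` W)" using lower by (auto simp: bdd_below_def)
  have ne: "J ` W \<noteq> {}" using subspace_0[OF W] by blast
  have m_le: "m \<le> J v" if "v \<in> W" for v
    unfolding m_def using bdd that by (intro cInf_lower) auto
  have "\<exists>w\<in>W. J w < m + 1 / real (Suc n)" for n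
    using cInf_lessD[OF ne, of "m + 1 / real (Suc n)"] unfolding m_def by auto
  then obtain w where w: "\<And>n. w n \<in> W" "\<And>n. J (w n) < m + 1 / real (Suc n)" by metis
  \<comment> \<open>Parallelogram identity at the midpoint of \<open>u\<close> and \<open>v\<close>:
    two near-minimisers of \<open>J\<close> must be close, so a minimising sequence is
    Cauchy.\<close>
  have par: "c * (norm (u - v))\<^sup>2 / 8 \<le> (J u + J v) / 2 - m" if "u \<in> W" "v \<in> W" for u v
  proof -
    have "(1/2) *\<^sub>R (u + v) \<in> W" using that W by (intro subspace_scale subspace_add)
    then have "m \<le> J ((1/2) *\<^sub>R (u + v))" by (rule m_le)
    also have "\<dots> = (s u u + s v v + 2 * s u v) / 8 - (l u + l v) / 2"
      using that subspace_add[OF W that] sym[of v u]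
      unfolding J_def by (simp only: l s.add_left s.add_right s.scaleR_left s.scaleR_right)
        (simp add: field_simps)
    also have "\<dots> = (J u + J v) / 2 - s (u - v) (u - v) / 8"
      using sym[of v u] by (simp add: J_def s.diff_left s.diff_right field_simps)
    finally show ?thesis using c(2)[of "u - v"] by linarith
  qed
  have "Cauchy w"
  proof (rule metric_CauchyI)
    fix e :: real assume e: "e > 0"
    obtain N where N: "8 / (c * e\<^sup>2) < real N" using reals_Archimedean2 by blast
    have small: "1 / real (Suc n) < c * e\<^sup>2 / 8" if "n \<ge> N" for n
    proof -
      have "8 / (c * e\<^sup>2) < real (Suc n)" using N that by linarith
      then show ?thesis using c e by (simp add: field_simps)
    qed
    show "\<exists>M. \<forall>m\<ge>M. \<forall>n\<ge>M. dist (w m) (w n) < e"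
    proof (intro exI[of _ N] allI impI)
      fix p n assume "p \<ge> N" "n \<ge> N"
      then have "c * (norm (w p - w n))\<^sup>2 / 8 < c * e\<^sup>2 / 8"
        using par[OF w(1)[of p] w(1)[of n]] w(2)[of p] w(2)[of n] small[of p] small[of n] by argo
      then have "(norm (w p - w n))\<^sup>2 < e\<^sup>2" using c by simp
      then show "dist (w p) (w n) < e" using e by (simp add: dist_norm power_less_imp_less_base)
    qed
  qed
  then obtain u where u: "w \<longlonglongrightarrow> u" using Cauchy_convergent convergent_def by blast
  have sol: "s u v = l v" if v: "v \<in> W" for v
  proof -
    \<comment> \<open>The limit \<open>u\<close> may lie outside \<open>W\<close>, where nothing is
      known of \<open>l\<close>. The variation is therefore made at \<open>w n\<close>, at the cost
      of an error 1/(n+1), before passing to the limit.\<close>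
    have ineq: "0 \<le> \<tau> * (s u v - l v) + \<tau>\<^sup>2 / 2 * s v v" for \<tau>
    proof (rule LIMSEQ_le_const)
      have "(\<lambda>n. \<tau> * (s (w n) v - l v) + \<tau>\<^sup>2 / 2 * s v v + 1 / real (Suc n))
          \<longlonglongrightarrow> \<tau> * (s u v - l v) + \<tau>\<^sup>2 / 2 * s v v + 0"
        by (intro tendsto_intros s.tendsto u LIMSEQ_Suc[OF lim_1_over_n])
      then show "(\<lambda>n. \<tau> * (s (w n) v - l v) + \<tau>\<^sup>2 / 2 * s v v + 1 / real (Suc n))
          \<longlonglongrightarrow> \<tau> * (s u v - l v) + \<tau>\<^sup>2 / 2 * s v v" by simp
      have "0 \<le> \<tau> * (s (w n) v - l v) + \<tau>\<^sup>2 / 2 * s v v + 1 / real (Suc n)" for n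
      proof -
        have "\<tau> *\<^sub>R v \<in> W" using v W by (rule subspace_scale[rotated])
        moreover from this have "m \<le> J (w n + \<tau> *\<^sub>R v)"
          using w(1) W by (intro m_le subspace_add)
        ultimately have "m \<le> J (w n) + \<tau> * (s (w n) v - l v) + \<tau>\<^sup>2 / 2 * s v v"
          using w(1)[of n] v sym[of v "w n"]
          by (simp add: J_def l s.add_left s.add_right s.scaleR_left s.scaleR_right field_simps power2_eq_square)
        then show ?thesis using w(2)[of n] by linarith
      qed
      then show "\<exists>N. \<forall>n\<ge>N. 0 \<le> \<tau> * (s (w n) v - l v) + \<tau>\<^sup>2 / 2 * s v v + 1 / real (Suc n)" by blast
    qed
    define d where "d = s u v - l v"
    define S where "S = s v v"
    have S: "S \<ge> 0" using c(2)[of v] c(1) unfolding S_def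
      by (meson mult_nonneg_nonneg order_trans less_imp_le zero_le_power2)
    \<comment> \<open>With step \<open>- q * d\<close> and \<open>q * S \<le> 1\<close> the
      quadratic term is at most half of the linear decrease. Adding 1 covers the case S = 0.\<close>
    define q where "q = 1 / (S + 1)"
    have q: "q > 0" "q * S \<le> 1" using S unfolding q_def by (auto simp: field_simps)
    have "0 \<le> - q * d * d + (- q * d)\<^sup>2 / 2 * S"
      using ineq[of "- q * d"] unfolding d_def S_def .
    also have "\<dots> = - (q * d\<^sup>2) + (q * d\<^sup>2) * (q * S) / 2"
      by (simp add: power2_eq_square algebra_simps)
    also have "\<dots> \<le> - (q * d\<^sup>2) + (q * d\<^sup>2) * 1 / 2"
      using q by (intro add_left_mono divide_right_mono mult_left_mono) auto
    finally have "q * d\<^sup>2 \<le> 0" by simp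
    then have "d = 0" using q(1) by (simp add: mult_le_0_iff)
    then show ?thesis unfolding d_def by simp
  qed
  have "u \<in> closure W"
    unfolding closure_sequential using u w(1) by blast
  from this sol show thesis by (rule that)
qed

lemma riesz_representation_form:
  fixes s :: "'v::banach \<Rightarrow> 'v \<Rightarrow> real"
  assumes "bounded_bilinear s" and "\<And>u v. s u v = s v u"
    and "c > 0" "\<And>u. c * (norm u)\<^sup>2 \<le> s u u" and l: "bounded_linear l"
  shows "\<exists>u. \<forall>v. s u v = l v"
proof -
  interpret l: bounded_linear l by (rule l)
  obtain K where K: "\<And>u. \<bar>l u\<bar> \<le> K * norm u"
    using l.bounded by (auto simp: mult.commute)
  show ?thesis
    by (rule riesz_representation_subspace[of s c UNIV l K])
      (use assms K in \<open>auto simp: l.add l.scaleR\<close>)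
qed

lemma bounded_bilinear_add_fun:
  assumes "bounded_bilinear (f :: 'a::real_normed_vector \<Rightarrow> 'b::real_normed_vector \<Rightarrow> 'c::real_normed_vector)"
    and "bounded_bilinear g"
  shows "bounded_bilinear (\<lambda>u v. f u v + g u v)"
proof -
  interpret f: bounded_bilinear f by fact
  interpret g: bounded_bilinear g by fact
  obtain K L where KL: "\<And>a b. norm (f a b) \<le> norm a * norm b * K" "\<And>a b. norm (g a b) \<le> norm a * norm b * L"
    using f.bounded g.bounded by blast
  show ?thesis
  proof (standard, goal_cases)
    case 5
    have "norm (f a b + g a b) \<le> norm a * norm b * (K + L)" for a b
      using KL[of a b] norm_triangle_ineq[of "f a b" "g a b"] by (simp add: distrib_left)
    then show ?case by blast
  qed (simp_all add: f.add_left f.add_right g.add_left g.add_right f.scaleR_left f.scaleR_right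
      g.scaleR_left g.scaleR_right scaleR_add_right)
qed

text \<open>Writing \<open>b u v = s (B u) v\<close> with the symmetric part \<open>s\<close>, the equation \<open>B u = f\<close> is solved by least
  squares, i.e. by representing a functional with the symmetric coercive form \<open>s (B u) (B v)\<close>.\<close>

lemma Lax_Milgram:
  fixes b :: "'v::banach \<Rightarrow> 'v \<Rightarrow> real"
  assumes b: "bounded_bilinear b" and c: "c > 0" "\<And>u. c * (norm u)\<^sup>2 \<le> b u u" and l: "bounded_linear l"
  shows "\<exists>u. \<forall>v. b u v = l v"
proof -
  interpret b: bounded_bilinear b by (rule b)
  define s where "s u v = b u v + b v u" for u v
  have s_bil: "bounded_bilinear s"
    unfolding s_def by (intro bounded_bilinear_add_fun b bounded_bilinear.flip[OF b])
  interpret s: bounded_bilinear s by (rule s_bil)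
  have sym: "s u v = s v u" for u v by (simp add: s_def)
  have sc: "c * (norm u)\<^sup>2 \<le> s u u" for u
  proof -
    have "0 \<le> c * (norm u)\<^sup>2" using c(1) by simp
    then show ?thesis using c(2)[of u] unfolding s_def by linarith
  qed
  have "\<exists>w. \<forall>v. s w v = b u v" for u
    by (rule riesz_representation_form[OF s_bil sym c(1) sc b.bounded_linear_right])
  then obtain B where B: "\<And>u v. s (B u) v = b u v" by metis
  have unique: "u = u'" if "\<And>v. s u v = s u' v" for u u'
  proof -
    have "s (u - u') (u - u') = 0" using that by (simp add: s.diff_left)
    then show ?thesis using sc[of "u - u'"] c(1) by (simp add: mult_le_0_iff)
  qed
  obtain K where K: "K > 0" "\<And>u v. norm (s u v) \<le> norm u * norm v * K" using s.pos_bounded by blast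
  obtain L where L: "L > 0" "\<And>u v. norm (b u v) \<le> norm u * norm v * L" using b.pos_bounded by blast
  have "bounded_linear B"
  proof (rule bounded_linear_intro)
    show "B (u + v) = B u + B v" for u v by (rule unique) (simp add: B s.add_left b.add_left)
    show "B (r *\<^sub>R u) = r *\<^sub>R B u" for r u by (rule unique) (simp add: B s.scaleR_left b.scaleR_left)
    show "norm (B u) \<le> norm u * (L / c)" for u
    proof -
      have "c * (norm (B u))\<^sup>2 \<le> norm u * norm (B u) * L"
        using sc[of "B u"] L(2)[of u "B u"] by (simp add: B)
      then have "c * norm (B u) * norm (B u) \<le> (norm u * L) * norm (B u)"
        by (simp add: power2_eq_square mult_ac)
      then have "c * norm (B u) \<le> norm u * L \<or> norm (B u) = 0"
        by (simp add: mult_le_cancel_right) linarith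
      then show ?thesis using c(1) L(1) by (auto simp: field_simps)
    qed
  qed
  then interpret B: bounded_linear B .
  \<comment> \<open>Coercivity of \<open>b\<close> bounds \<open>B\<close> from below, and so
    transfers coercivity from \<open>s\<close> to \<open>s2\<close>.\<close>
  have lower: "c * norm u \<le> K * norm (B u)" for u
  proof -
    have "c * (norm u)\<^sup>2 \<le> norm (B u) * norm u * K"
      using c(2)[of u] K(2)[of "B u" u] by (simp add: B)
    then have "(c * norm u) * norm u \<le> (K * norm (B u)) * norm u"
      by (simp add: power2_eq_square mult_ac)
    then show ?thesis using K(1) by (auto simp: mult_le_cancel_right)
  qed
  define s2 where "s2 u v = s (B u) (B v)" for u v
  have "bounded_bilinear s2"
    unfolding s2_def using \<open>bounded_linear B\<close> by (intro s.comp)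
  moreover have "s2 u v = s2 v u" for u v by (simp add: s2_def sym)
  moreover have "c * (c / K)\<^sup>2 * (norm u)\<^sup>2 \<le> s2 u u" for u
  proof -
    have "(c / K * norm u)\<^sup>2 \<le> (norm (B u))\<^sup>2"
      using lower[of u] c(1) K(1) by (intro power_mono) (auto simp: field_simps)
    then have "c * (c / K * norm u)\<^sup>2 \<le> c * (norm (B u))\<^sup>2" using c(1) by simp
    then show ?thesis using sc[of "B u"] unfolding s2_def power_mult_distrib mult.assoc by linarith
  qed
  moreover have "c * (c / K)\<^sup>2 > 0" using c K by simp
  moreover obtain f where f: "\<And>v. s f v = l v"
    using riesz_representation_form[OF s_bil sym c(1) sc l] by blast
  moreover have "bounded_linear (\<lambda>v. s f (B v))"
    by (rule bounded_linear_compose[OF s.bounded_linear_right \<open>bounded_linear B\<close>])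
  ultimately obtain u where u: "\<And>v. s2 u v = s f (B v)"
    using riesz_representation_form[of s2 "c * (c / K)\<^sup>2" "\<lambda>v. s f (B v)"] by blast
  \<comment> \<open>The normal equation says that \<open>B u - f\<close> is s-orthogonal to every
    \<open>B v\<close>, and \<open>s (B v) w = b v w\<close>. Taking v to be the residual itself,
    coercivity forces it to vanish.\<close>
  have "b v (B u - f) = 0" for v
    using u[of v] by (simp add: B[symmetric] s2_def s.diff_right sym)
  from this[of "B u - f"] have "B u = f"
    using c(2)[of "B u - f"] c(1) by (simp add: mult_le_0_iff)
  then have "\<forall>v. b u v = l v" using f by (simp add: B[symmetric])
  then show ?thesis ..
qed

subsection \<open>Resolvents of coercive real forms\<close>

text \<open>If \<open>A\<close> is the operator of the form \<open>b\<close>, then \<open>j (form_resolvent j b t x)\<close> is \<open>(t + A)\<^sup>-\<^sup>1 x\<close>.\<close>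

definition form_resolvent :: "('v \<Rightarrow> 'h::real_inner) \<Rightarrow> ('v \<Rightarrow> 'v \<Rightarrow> real) \<Rightarrow> real \<Rightarrow> 'h \<Rightarrow> 'v"
  where "form_resolvent j b t x = (THE u. \<forall>\<phi>. b u \<phi> + t * (j u \<bullet> j \<phi>) = x \<bullet> j \<phi>)"

locale coercive_form =
  fixes j :: "'v::banach \<Rightarrow> 'h::{real_inner,banach}" and b :: "'v \<Rightarrow> 'v \<Rightarrow> real"
  assumes j_lin: "bounded_linear j" and j_inj: "inj j" and j_dense: "closure (range j) = UNIV"
    and b_bil: "bounded_bilinear b" and coercive: "\<exists>c>0. \<forall>u. c * (norm u)\<^sup>2 \<le> b u u"
begin

sublocale j: bounded_linear j by (rule j_lin)
sublocale b: bounded_bilinear b by (rule b_bil)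

text \<open>The flipped form belongs to the adjoint operator, so every result of the locale holds
  for \<open>R'\<close> and \<open>F'\<close> as well.\<close>

lemma flip: "coercive_form j (\<lambda>u v. b v u)"
  using j_lin j_inj j_dense bounded_bilinear.flip[OF b_bil] coercive by (rule coercive_form.intro)

abbreviation "Rv \<equiv> form_resolvent j b"
abbreviation "R t x \<equiv> j (Rv t x)"
abbreviation "Rv' \<equiv> form_resolvent j (\<lambda>u v. b v u)"
abbreviation "R' t x \<equiv> j (Rv' t x)"

lemma b_nonneg: "b u u \<ge> 0"
  using coercive by (meson less_imp_le mult_nonneg_nonneg order_trans zero_le_power2)

lemma b_eq_0: "b u u \<le> 0 \<Longrightarrow> u = 0"
  using coercive by (metis (no_types, opaque_lifting) mult_le_0_iff norm_eq_zero not_less order_trans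
      power_eq_0_iff zero_less_power2)

lemma resolvent_form_exists:
  assumes "t \<ge> 0"
  shows "\<exists>u. \<forall>\<phi>. b u \<phi> + t * (j u \<bullet> j \<phi>) = x \<bullet> j \<phi>"
proof -
  obtain c where c: "c > 0" "\<And>u. c * (norm u)\<^sup>2 \<le> b u u" using coercive by blast
  have "bounded_bilinear (\<lambda>u \<phi>. j u \<bullet> (t *\<^sub>R j \<phi>))"
    by (rule bounded_bilinear.comp[OF bounded_bilinear_inner j_lin])
      (rule bounded_linear_const_scaleR[OF j_lin])
  then have "bounded_bilinear (\<lambda>u \<phi>. t * (j u \<bullet> j \<phi>))" by simp
  then have "bounded_bilinear (\<lambda>u \<phi>. b u \<phi> + t * (j u \<bullet> j \<phi>))"
    by (rule bounded_bilinear_add_fun[OF b_bil])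
  moreover have "c * (norm u)\<^sup>2 \<le> b u u + t * (j u \<bullet> j u)" for u
    using c(2)[of u] assms by (simp add: add_increasing2)
  moreover have "bounded_linear (\<lambda>\<phi>. x \<bullet> j \<phi>)"
    by (rule bounded_linear_compose[OF bounded_linear_inner_right j_lin])
  ultimately show ?thesis
    using c(1) Lax_Milgram[of "\<lambda>u \<phi>. b u \<phi> + t * (j u \<bullet> j \<phi>)" c "\<lambda>\<phi>. x \<bullet> j \<phi>"] by blast
qed

lemma resolvent_form_unique:
  assumes "t \<ge> 0" "\<And>\<phi>. b u \<phi> + t * (j u \<bullet> j \<phi>) = b w \<phi> + t * (j w \<bullet> j \<phi>)"
  shows "u = w"
proof -
  have "b (u - w) (u - w) + t * (j (u - w) \<bullet> j (u - w)) = 0"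
    using assms(2)[of "u - w"] by (simp add: b.diff_left j.diff inner_diff_left algebra_simps)
  moreover have "t * (j (u - w) \<bullet> j (u - w)) \<ge> 0" using assms(1) by simp
  ultimately have "u - w = 0" by (intro b_eq_0) linarith
  then show ?thesis by simp
qed

lemma resolvent_eq: "t \<ge> 0 \<Longrightarrow> b (Rv t x) \<phi> + t * (R t x \<bullet> j \<phi>) = x \<bullet> j \<phi>"
proof -
  assume t: "t \<ge> 0"
  have "\<exists>!u. \<forall>\<phi>. b u \<phi> + t * (j u \<bullet> j \<phi>) = x \<bullet> j \<phi>"
    using resolvent_form_exists[OF t] resolvent_form_unique[OF t] by (metis (no_types, lifting))
  from theI'[OF this] show ?thesis unfolding form_resolvent_def by blast
qed

lemma resolvent_eqI: "t \<ge> 0 \<Longrightarrow> (\<And>\<phi>. b u \<phi> + t * (j u \<bullet> j \<phi>) = x \<bullet> j \<phi>) \<Longrightarrow> Rv t x = u"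
  by (rule resolvent_form_unique) (auto simp: resolvent_eq)

lemma resolvent_0_eq: "b (Rv 0 x) \<phi> = x \<bullet> j \<phi>"
  using resolvent_eq[of 0 x \<phi>] by simp

lemma Rv_add: "t \<ge> 0 \<Longrightarrow> Rv t (x + y) = Rv t x + Rv t y"
  using resolvent_eq[of t x] resolvent_eq[of t y]
  by (intro resolvent_eqI) (auto simp: b.add_left j.add inner_add_left algebra_simps)

lemma Rv_scaleR: "t \<ge> 0 \<Longrightarrow> Rv t (r *\<^sub>R x) = r *\<^sub>R Rv t x"
proof (rule resolvent_eqI)
  fix \<phi> assume "t \<ge> 0"
  then have "r * (b (Rv t x) \<phi> + t * (R t x \<bullet> j \<phi>)) = r * (x \<bullet> j \<phi>)"
    using resolvent_eq[of t x \<phi>] by simp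
  then show "b (r *\<^sub>R Rv t x) \<phi> + t * (j (r *\<^sub>R Rv t x) \<bullet> j \<phi>) = (r *\<^sub>R x) \<bullet> j \<phi>"
    by (simp add: b.scaleR_left j.scaleR algebra_simps)
qed

lemma Rv_diff: "t \<ge> 0 \<Longrightarrow> Rv t (x - y) = Rv t x - Rv t y"
  using Rv_add[of t x "- y"] Rv_scaleR[of t "- 1" y] by simp

text \<open>The equation is tested with its own solution. The gap \<delta> comes from comparing the
  norm of V with that of H; it keeps the resolvent bounded down to t = 0, where the bound 1/t alone
  would make the square root integral diverge.\<close>

lemma resolvent_bounds:
  obtains \<delta> K where "\<delta> > 0" "K > 0" "\<And>t x. t \<ge> 0 \<Longrightarrow> (t + \<delta>) * norm (R t x) \<le> norm x"
    "\<And>t x. t \<ge> 0 \<Longrightarrow> norm (Rv t x) \<le> K * norm x"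
proof -
  obtain c where c: "c > 0" "\<And>u. c * (norm u)\<^sup>2 \<le> b u u" using coercive by blast
  obtain k where k: "k > 0" "\<And>u. norm (j u) \<le> norm u * k" using j.pos_bounded by blast
  define \<delta> where "\<delta> = c / k\<^sup>2"
  have e: "c * (norm (Rv t x))\<^sup>2 + t * (norm (R t x))\<^sup>2 \<le> norm x * norm (R t x)" if "t \<ge> 0" for t x
    using resolvent_eq[OF that, of x "Rv t x"] c(2)[of "Rv t x"] norm_cauchy_schwarz[of x "R t x"]
    by (simp add: power2_norm_eq_inner)
  have 1: "(t + \<delta>) * norm (R t x) \<le> norm x" if t: "t \<ge> 0" for t x
  proof -
    have "(norm (R t x))\<^sup>2 \<le> (norm (Rv t x) * k)\<^sup>2"
      using k(2) by (intro power_mono) auto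
    then have "\<delta> * (norm (R t x))\<^sup>2 \<le> c * (norm (Rv t x))\<^sup>2"
      using c(1) k(1) unfolding \<delta>_def by (simp add: field_simps)
    then have "((t + \<delta>) * norm (R t x)) * norm (R t x) \<le> norm x * norm (R t x)"
      using e[OF t, of x] by (simp add: power2_eq_square algebra_simps)
    then show ?thesis by (cases "norm (R t x) = 0") (auto simp: mult_le_cancel_right)
  qed
  have 2: "norm (Rv t x) \<le> k / c * norm x" if t: "t \<ge> 0" for t x
  proof -
    have "0 \<le> t * (norm (R t x))\<^sup>2" using t by simp
    then have "c * (norm (Rv t x))\<^sup>2 \<le> norm x * norm (R t x)" using e[OF t, of x] by linarith
    also have "\<dots> \<le> norm x * (norm (Rv t x) * k)"
      using k(2) by (intro mult_left_mono) auto
    finally have "(c * norm (Rv t x)) * norm (Rv t x) \<le> (k * norm x) * norm (Rv t x)"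
      by (simp add: power2_eq_square mult_ac)
    then have "c * norm (Rv t x) \<le> k * norm x"
      using k(1) by (cases "norm (Rv t x) = 0") (auto simp: mult_le_cancel_right)
    then show ?thesis using c(1) by (simp add: field_simps)
  qed
  show thesis by (rule that[OF _ _ 1 2]) (use c k in \<open>auto simp: \<delta>_def\<close>)
qed

lemma norm_scaled_resolvent_le: "t \<ge> 0 \<Longrightarrow> norm (t *\<^sub>R R t x) \<le> norm x"
proof -
  assume t: "t \<ge> 0"
  obtain \<delta> where \<delta>: "\<delta> > 0" "(t + \<delta>) * norm (R t x) \<le> norm x"
    using resolvent_bounds t by metis
  have "t * norm (R t x) \<le> (t + \<delta>) * norm (R t x)"
    using \<delta>(1) by (intro mult_right_mono) auto
  then show ?thesis using \<delta>(2) t by simp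
qed

lemma bounded_linear_Rv: "t \<ge> 0 \<Longrightarrow> bounded_linear (Rv t)"
proof -
  assume t: "t \<ge> 0"
  obtain K where "\<And>x. norm (Rv t x) \<le> K * norm x" using resolvent_bounds t by metis
  then show ?thesis
    by (intro bounded_linear_intro[of _ K]) (simp_all add: t Rv_add Rv_scaleR mult.commute)
qed

lemma bounded_linear_R: "t \<ge> 0 \<Longrightarrow> bounded_linear (R t)"
  using bounded_linear_compose[OF j_lin bounded_linear_Rv] by (simp add: o_def)

section \<open>Resolvent identity, adjoints, derivatives and density of the domain\<close>

lemma resolvent_identity_Rv:
  assumes "t \<ge> 0" "s \<ge> 0"
  shows "Rv t x - Rv s x = (s - t) *\<^sub>R Rv t (R s x)"
proof (rule resolvent_form_unique[OF assms(1)])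
  fix \<phi>
  show "b (Rv t x - Rv s x) \<phi> + t * (j (Rv t x - Rv s x) \<bullet> j \<phi>)
      = b ((s - t) *\<^sub>R Rv t (R s x)) \<phi> + t * (j ((s - t) *\<^sub>R Rv t (R s x)) \<bullet> j \<phi>)"
    using resolvent_eq[OF assms(1), of x \<phi>] resolvent_eq[OF assms(2), of x \<phi>]
      arg_cong[OF resolvent_eq[OF assms(1), of "R s x" \<phi>], of "\<lambda>r. (s - t) * r"]
    by (simp add: b.diff_left b.scaleR_left j.diff j.scaleR inner_diff_left algebra_simps)
qed

lemma resolvent_identity:
  "t \<ge> 0 \<Longrightarrow> s \<ge> 0 \<Longrightarrow> R t x - R s x = (s - t) *\<^sub>R R t (R s x)"
  using arg_cong[OF resolvent_identity_Rv, of t s j x] by (simp add: j.diff j.scaleR)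

lemma resolvent_commute: "t \<ge> 0 \<Longrightarrow> s \<ge> 0 \<Longrightarrow> R t (R s x) = R s (R t x)"
proof (cases "t = s")
  case False
  assume "t \<ge> 0" "s \<ge> 0"
  then have "(s - t) *\<^sub>R R t (R s x) = (s - t) *\<^sub>R R s (R t x)"
    using resolvent_identity[of t s x] resolvent_identity[of s t x]
    by (metis minus_diff_eq scaleR_minus_left)
  then show ?thesis using False by simp
qed simp

text \<open>Each of the two resolvent equations is tested with the solution of the other.\<close>

lemma resolvent_adjoint: "t \<ge> 0 \<Longrightarrow> R t x \<bullet> y = x \<bullet> R' t y"
proof -
  assume t: "t \<ge> 0"
  interpret adj: coercive_form j "\<lambda>u v. b v u" by (rule flip)
  show ?thesis
    using resolvent_eq[OF t, of x "Rv' t y"] adj.resolvent_eq[OF t, where x = y and \<phi> = "Rv t x"]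
    by (simp add: inner_commute)
qed

text \<open>Two applications of the resolvent identity give the exact remainder
  \<open>(s - t)^2 R(s) R(t)^2 x\<close>, bounded through the gap \<delta>. The derivative is taken
  within the half-line because resolvents are only available there.\<close>

lemma resolvent_has_vector_derivative:
  assumes "t \<ge> 0"
  shows "((\<lambda>t. R t x) has_vector_derivative - R t (R t x)) (at t within {0..})"
proof -
  obtain \<delta> where \<delta>: "\<delta> > 0" "\<And>t x. t \<ge> 0 \<Longrightarrow> (t + \<delta>) * norm (R t x) \<le> norm x"
    using resolvent_bounds by metis
  have le: "norm (R t x) \<le> norm x / \<delta>" if "t \<ge> 0" for t x
  proof -
    have "\<delta> * norm (R t x) \<le> (t + \<delta>) * norm (R t x)" using that by (intro mult_right_mono) auto
    also note \<delta>(2)[OF that]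
    finally show ?thesis using \<delta>(1) by (simp add: field_simps)
  qed
  define C where "C = norm (R t (R t x)) / \<delta>"
  have err: "norm (R s x - R t x - (s - t) *\<^sub>R (- R t (R t x))) \<le> C * \<bar>s - t\<bar>\<^sup>2" if s: "s \<ge> 0" for s
  proof -
    have "R s x - R t x - (s - t) *\<^sub>R (- R t (R t x)) = (s - t) *\<^sub>R (R t (R t x) - R s (R t x))"
      unfolding resolvent_identity[OF s assms] by (simp add: algebra_simps)
    also have "\<dots> = (s - t)\<^sup>2 *\<^sub>R R s (R t (R t x))"
      unfolding resolvent_identity[OF assms s] resolvent_commute[OF assms s]
      by (simp add: power2_eq_square)
    finally show ?thesis
      using mult_left_mono[OF le[OF s, of "R t (R t x)"], of "\<bar>s - t\<bar>\<^sup>2"] by (simp add: C_def mult.commute)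
  qed
  show ?thesis
    unfolding has_vector_derivative_def has_derivative_iff_norm
  proof (intro conjI bounded_linear_scaleR_left)
    have "((\<lambda>s. C * \<bar>s - t\<bar>) \<longlongrightarrow> C * \<bar>t - t\<bar>) (at t within {0..})"
      by (intro tendsto_intros)
    then have lim: "((\<lambda>s. C * \<bar>s - t\<bar>) \<longlongrightarrow> 0) (at t within {0..})" by simp
    show "((\<lambda>s. norm (R s x - R t x - (s - t) *\<^sub>R (- R t (R t x))) / norm (s - t)) \<longlongrightarrow> 0) (at t within {0..})"
    proof (rule tendsto_sandwich[OF _ _ tendsto_const lim])
      show "\<forall>\<^sub>F s in at t within {0..}.
          norm (R s x - R t x - (s - t) *\<^sub>R (- R t (R t x))) / norm (s - t) \<le> C * \<bar>s - t\<bar>"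
        unfolding eventually_at_filter
        by (rule always_eventually) (use err in \<open>auto simp: divide_le_eq power2_eq_square mult.assoc\<close>)
    qed simp
  qed
qed

lemma continuous_on_resolvent: "continuous_on {0..} (\<lambda>t. R t x)"
  by (rule continuous_on_vector_derivative) (use resolvent_has_vector_derivative in auto)

lemma resolvent_square_has_vector_derivative:
  assumes "t \<ge> 0"
  shows "((\<lambda>t. R t (R t x)) has_vector_derivative - 2 *\<^sub>R R t (R t (R t x))) (at t within {0..})"
proof -
  obtain \<delta> where \<delta>: "\<delta> > 0" "\<And>t x. t \<ge> 0 \<Longrightarrow> (t + \<delta>) * norm (R t x) \<le> norm x"
    using resolvent_bounds by metis
  have le: "norm (R s y) \<le> norm y / \<delta>" if "s \<ge> 0" for s y
  proof -
    have "\<delta> * norm (R s y) \<le> (s + \<delta>) * norm (R s y)" using that by (intro mult_right_mono) auto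
    also note \<delta>(2)[OF that]
    finally show ?thesis using \<delta>(1) by (simp add: field_simps)
  qed
  have lim: "((\<lambda>s. R s y) \<longlongrightarrow> R t y) (at t within {0..})" for y
    using continuous_on_resolvent[of y] assms by (auto simp: continuous_on_def)
  have split: "R s (R s x) - R t (R t x) - (s - t) *\<^sub>R (- 2 *\<^sub>R R t (R t (R t x)))
      = (s - t) *\<^sub>R (2 *\<^sub>R R t (R t (R t x)) - R s (R s (R t x)) - R s (R t (R t x)))" if s: "s \<ge> 0" for s
  proof -
    have "R s (R s x) - R t (R t x) = R s (R s x - R t x) + (R s (R t x) - R t (R t x))"
      by (simp add: Rv_diff s j.diff)
    also have "\<dots> = (t - s) *\<^sub>R R s (R s (R t x)) + (t - s) *\<^sub>R R s (R t (R t x))"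
      unfolding resolvent_identity[OF s assms]
      by (simp add: Rv_scaleR s j.scaleR)
    finally show ?thesis by (simp add: algebra_simps)
  qed
  \<comment> \<open>Strong continuity is applied to the inner resolvent, and the uniform bound to
    the outer one, which also moves with \<open>s\<close>.\<close>
  have lim2: "((\<lambda>s. R s (R s (R t x))) \<longlongrightarrow> R t (R t (R t x))) (at t within {0..})"
  proof -
    have "((\<lambda>s. R s (R s (R t x) - R t (R t x))) \<longlongrightarrow> 0) (at t within {0..})"
    proof (rule Lim_null_comparison)
      show "\<forall>\<^sub>F s in at t within {0..}. norm (R s (R s (R t x) - R t (R t x))) \<le> norm (R s (R t x) - R t (R t x)) / \<delta>"
        unfolding eventually_at_filter by (rule always_eventually) (use le in auto)
      have "((\<lambda>s. norm (R s (R t x) - R t (R t x)) / \<delta>) \<longlongrightarrow> norm (R t (R t x) - R t (R t x)) / \<delta>) (at t within {0..})"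
        using \<delta>(1) by (intro tendsto_intros lim) auto
      then show "((\<lambda>s. norm (R s (R t x) - R t (R t x)) / \<delta>) \<longlongrightarrow> 0) (at t within {0..})" by simp
    qed
    from tendsto_add[OF this lim[of "R t (R t x)"]]
    have "((\<lambda>s. R s (R s (R t x) - R t (R t x)) + R s (R t (R t x))) \<longlongrightarrow> R t (R t (R t x))) (at t within {0..})"
      by simp
    moreover have "\<forall>\<^sub>F s in at t within {0..}.
        R s (R s (R t x) - R t (R t x)) + R s (R t (R t x)) = R s (R s (R t x))"
      unfolding eventually_at_filter
      by (rule always_eventually) (auto simp: Rv_diff j.diff)
    ultimately show ?thesis
      by (rule Lim_transform_eventually)
  qed
  show ?thesis
    unfolding has_vector_derivative_def has_derivative_iff_norm
  proof (intro conjI bounded_linear_scaleR_left)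
    have "((\<lambda>s. norm (2 *\<^sub>R R t (R t (R t x)) - R s (R s (R t x)) - R s (R t (R t x))))
        \<longlongrightarrow> norm (2 *\<^sub>R R t (R t (R t x)) - R t (R t (R t x)) - R t (R t (R t x)))) (at t within {0..})"
      by (intro tendsto_intros lim lim2)
    then have "((\<lambda>s. norm (2 *\<^sub>R R t (R t (R t x)) - R s (R s (R t x)) - R s (R t (R t x)))) \<longlongrightarrow> 0)
        (at t within {0..})" by (simp add: scaleR_2)
    then show "((\<lambda>s. norm (R s (R s x) - R t (R t x) - (s - t) *\<^sub>R (- 2 *\<^sub>R R t (R t (R t x)))) / norm (s - t))
        \<longlongrightarrow> 0) (at t within {0..})"
      by (rule Lim_transform_eventually)
        (unfold eventually_at_filter, rule always_eventually, use split in auto)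
  qed
qed

text \<open>Let w be the projection of v on the closure of the range, orthogonal for the symmetric
  part \<open>s\<close> of the form. Writing the functional \<open>s (v - w)\<close> as b(u, q) for
  all u, orthogonality to the range says that \<open>j q\<close> is orthogonal to all of H. Hence q
  = 0 and v = w.\<close>

lemma resolvent_range_dense:
  assumes "e > 0"
  shows "\<exists>x. norm (Rv 0 x - v) < e"
proof -
  obtain c where c: "c > 0" "\<And>u. c * (norm u)\<^sup>2 \<le> b u u" using coercive by blast
  define s where "s u v = b u v + b v u" for u v
  have s_bil: "bounded_bilinear s"
    unfolding s_def by (intro bounded_bilinear_add_fun b_bil bounded_bilinear.flip[OF b_bil])
  interpret s: bounded_bilinear s by (rule s_bil)
  have sc: "c * (norm u)\<^sup>2 \<le> s u u" for u
    using c(2)[of u] b_nonneg[of u] unfolding s_def by linarith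
  let ?W = "range (Rv 0)"
  have W: "subspace ?W"
    by (rule linear_subspace_image) (use bounded_linear_Rv[of 0] bounded_linear.linear subspace_UNIV in auto)
  obtain K where K: "\<And>u. norm (s v u) \<le> norm u * K" 
    using bounded_linear.bounded[OF s.bounded_linear_right[of v]] by blast
  obtain w where w: "w \<in> closure ?W" "\<And>u. u \<in> ?W \<Longrightarrow> s w u = s v u"
    by (rule riesz_representation_subspace[OF s_bil _ c(1) sc W, of "s v" K])
      (use K in \<open>auto simp: s_def b.add_left b.add_right b.scaleR_left b.scaleR_right mult.commute algebra_simps\<close>)
  define z where "z = v - w"
  obtain q where q: "\<And>u. b u q = s z u"
    using Lax_Milgram[OF bounded_bilinear.flip[OF b_bil] c s.bounded_linear_right[of z]] by blast
  have "x \<bullet> j q = 0" for x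
    using q[of "Rv 0 x"] w(2)[of "Rv 0 x"] by (simp add: resolvent_0_eq z_def s.diff_left)
  then have "j q = 0" by (metis inner_eq_zero_iff)
  then have "q = 0" using j_inj j.zero by (metis injD)
  then have "s z z = 0" using q[of z] by (simp add: b.zero_right)
  then have "z = 0" using sc[of z] c(1) by (simp add: mult_le_0_iff)
  then have "v \<in> closure ?W" using w(1) by (simp add: z_def)
  then show ?thesis
    using assms unfolding closure_approachable by (auto simp: dist_norm)
qed

end

text \<open>The factor 1/\<pi> of Balakrishnan's formula is left out. The shift \<mu> is the
  parameter in which the integral is differentiated to compute its square at \<mu> = 0.\<close>

definition resolvent_sqrt_integral ::
    "('v \<Rightarrow> 'h::{real_inner,banach}) \<Rightarrow> ('v \<Rightarrow> 'v \<Rightarrow> real) \<Rightarrow> real \<Rightarrow> 'h \<Rightarrow> 'h"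
  where "resolvent_sqrt_integral j b \<mu> x =
    integral {0<..} (\<lambda>t. t powr (-1/2) *\<^sub>R j (form_resolvent j b (t + \<mu>) x))"

text \<open>The choice r = b/a balances the two terms. Since a or b may vanish, both are first
  enlarged by e, which then tends to 0.\<close>

lemma le_of_scaled_le:
  fixes q a b L :: real
  assumes le: "\<And>r. r > 0 \<Longrightarrow> q \<le> 2 * r * a\<^sup>2 + 4 * L * b\<^sup>2 / r" and "a \<ge> 0" "b \<ge> 0" "L \<ge> 0"
  shows "q \<le> (2 + 4 * L) * a * b"
proof -
  have lim: "((\<lambda>e. 2 * (a * (b + e)) + 4 * L * (b * (a + e))) \<longlongrightarrow> 2 * (a * (b + 0)) + 4 * L * (b * (a + 0))) (at_right 0)"
    by (intro tendsto_intros)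
  have "q \<le> 2 * (a * (b + 0)) + 4 * L * (b * (a + 0))"
  proof (rule tendsto_lowerbound[OF lim])
    show "\<forall>\<^sub>F e in at_right 0. q \<le> 2 * (a * (b + e)) + 4 * L * (b * (a + e))"
      unfolding eventually_at_filter
    proof (intro always_eventually allI impI)
      fix e :: real
      assume "e \<noteq> 0" "e \<in> {0<..}"
      then have e: "e > 0" by simp
      have ae: "a + e > 0" and be: "b + e > 0" using e assms by auto
      define r where "r = (b + e) / (a + e)"
      have "q \<le> 2 * r * a\<^sup>2 + 4 * L * b\<^sup>2 / r"
        using ae be unfolding r_def by (intro le) simp
      also have "\<dots> = 2 * (r * a\<^sup>2) + 4 * (L * (b\<^sup>2 / r))" by simp
      finally have "q \<le> 2 * (r * a\<^sup>2) + 4 * (L * (b\<^sup>2 / r))" .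
      moreover have "r * a\<^sup>2 \<le> a * (b + e)"
        using ae be assms e by (simp add: r_def field_simps power2_eq_square)
      moreover have "b\<^sup>2 / r \<le> b * (a + e)"
        using ae be assms e by (simp add: r_def field_simps power2_eq_square)
      then have "L * (b\<^sup>2 / r) \<le> L * (b * (a + e))"
        using assms(4) by (rule mult_left_mono)
      ultimately show "q \<le> 2 * (a * (b + e)) + 4 * L * (b * (a + e))" by linarith
    qed
  qed simp
  then show ?thesis by (simp add: algebra_simps)
qed

context coercive_form
begin

abbreviation "F \<equiv> resolvent_sqrt_integral j b"
abbreviation "F' \<equiv> resolvent_sqrt_integral j (\<lambda>u v. b v u)"

lemma continuous_on_resolvent_square: "continuous_on {0..} (\<lambda>t. R t (R t x))"
  by (rule continuous_on_vector_derivative) (use resolvent_square_has_vector_derivative in auto)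

section \<open>Quadratic estimates for resolvents\<close>

lemma has_vector_derivative_within_Icc_of_nonneg:
  assumes "(f has_vector_derivative f') (at t within {0..})" "0 \<le> (lo::real)"
  shows "(f has_vector_derivative f') (at t within {lo..hi})"
  by (rule has_vector_derivative_within_subset[OF assms(1)]) (use assms(2) in auto)

text \<open>The derivative of \<open>|t R(t) x|\<^sup>2\<close> is \<open>2 t |A w|\<^sup>2 + 2 t\<^sup>2 (A w, w)\<close> with \<open>w = R(t)\<^sup>2 x\<close>.\<close>

lemma integral_quadratic_estimate_le:
  assumes "0 \<le> lo" "lo \<le> hi"
  shows "integral {lo..hi} (\<lambda>t. 2 * t * (norm (R t x - t *\<^sub>R R t (R t x)))\<^sup>2) \<le> (norm x)\<^sup>2"
proof -
  define h where "h t = t\<^sup>2 * (R t x \<bullet> R t x)" for t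
  define h' where "h' t = 2 * t * (R t x \<bullet> R t x) - 2 * t\<^sup>2 * (R t (R t x) \<bullet> R t x)" for t
  have D: "(h has_vector_derivative h' t) (at t within {lo..hi})" if "t \<in> {lo..hi}" for t
  proof -
    have "((\<lambda>t. R t x) has_vector_derivative - R t (R t x)) (at t within {lo..hi})"
      using that assms by (intro has_vector_derivative_within_Icc_of_nonneg resolvent_has_vector_derivative) auto
    then have "((\<lambda>t. R t x) has_derivative (\<lambda>h. h *\<^sub>R (- R t (R t x)))) (at t within {lo..hi})"
      by (simp add: has_vector_derivative_def)
    then show ?thesis
      unfolding has_vector_derivative_def h_def h'_def
      by (auto intro!: derivative_eq_intros ext simp: inner_commute algebra_simps power2_eq_square)
  qed
  have int_h: "(h' has_integral h hi - h lo) {lo..hi}"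
    by (rule fundamental_theorem_of_calculus[OF assms(2) D])
  have sub: "{lo..hi} \<subseteq> {0..}" using assms by auto
  have "(\<lambda>t. 2 * t * (norm (R t x - t *\<^sub>R R t (R t x)))\<^sup>2) integrable_on {lo..hi}"
    by (intro integrable_continuous_real continuous_intros
        continuous_on_subset[OF continuous_on_resolvent sub] continuous_on_subset[OF continuous_on_resolvent_square sub])
  then have "integral {lo..hi} (\<lambda>t. 2 * t * (norm (R t x - t *\<^sub>R R t (R t x)))\<^sup>2) \<le> h hi - h lo"
  proof (rule has_integral_le[OF integrable_integral int_h])
    fix t assume "t \<in> {lo..hi}"
    then have t: "t \<ge> 0" using assms by simp
    define u w g where "u = R t x" and "w = R t (R t x)" and "g = u - t *\<^sub>R w"
    \<comment> \<open>Here \<open>g\<close> is A w, so this is accretivity of A at w.\<close>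
    have "g \<bullet> w = b (Rv t (R t x)) (Rv t (R t x))"
      using resolvent_eq[OF t, of "R t x" "Rv t (R t x)"]
      unfolding g_def u_def w_def by (simp add: inner_diff_left inner_commute algebra_simps)
    then have "g \<bullet> w \<ge> 0" by (simp add: b_nonneg)
    moreover have "h' t = 2 * t * (g \<bullet> g) + 2 * t\<^sup>2 * (g \<bullet> w)"
      unfolding h'_def w_def[symmetric] unfolding u_def[symmetric] g_def
      by (simp add: inner_diff_left inner_diff_right inner_commute[of w u] power2_eq_square algebra_simps)
    ultimately show "2 * t * (norm (R t x - t *\<^sub>R R t (R t x)))\<^sup>2 \<le> h' t"
      unfolding w_def[symmetric] unfolding u_def[symmetric] g_def[symmetric] by (simp add: power2_norm_eq_inner)
  qed
  also have "\<dots> \<le> (norm (hi *\<^sub>R R hi x))\<^sup>2"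
    by (simp add: h_def power2_norm_eq_inner[symmetric] power_mult_distrib)
  also have "\<dots> \<le> (norm x)\<^sup>2"
    using assms by (intro power_mono norm_scaled_resolvent_le) auto
  finally show ?thesis .
qed

text \<open>Symmetry makes the integrand the derivative of \<open>h\<close>, where
  \<open>h t\<close> is the form evaluated at \<open>t R(t) v\<close> and v. It only remains to see
  that \<open>h\<close> stays between 0 and \<open>b v v\<close>.\<close>

lemma symmetric_integral_le:
  assumes sym: "\<And>u v. b u v = b v u" and "0 \<le> lo" "lo \<le> hi"
  shows "integral {lo..hi} (\<lambda>t. (norm (j v - t *\<^sub>R R t (j v)))\<^sup>2) \<le> b v v"
proof -
  define h where "h t = t * (j v \<bullet> j v) - t\<^sup>2 * (R t (j v) \<bullet> j v)" for t
  define h' where "h' t = (norm (j v - t *\<^sub>R R t (j v)))\<^sup>2" for t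
  have D: "(h has_vector_derivative h' t) (at t within {lo..hi})" if "t \<in> {lo..hi}" for t
  proof -
    have t: "t \<ge> 0" using that assms by simp
    have "((\<lambda>t. R t (j v)) has_vector_derivative - R t (R t (j v))) (at t within {lo..hi})"
      using that assms by (intro has_vector_derivative_within_Icc_of_nonneg resolvent_has_vector_derivative) auto
    then have 1: "((\<lambda>t. R t (j v)) has_derivative (\<lambda>h. h *\<^sub>R (- R t (R t (j v))))) (at t within {lo..hi})"
      by (simp add: has_vector_derivative_def)
    have "R t (R t (j v)) \<bullet> j v = R t (j v) \<bullet> R t (j v)"
      using resolvent_adjoint[OF t, of "R t (j v)" "j v"] sym by simp
    then have h't: "h' t = j v \<bullet> j v - 2 * t * (R t (j v) \<bullet> j v) + t\<^sup>2 * (R t (R t (j v)) \<bullet> j v)"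
      unfolding h'_def power2_norm_eq_inner by (simp add: inner_diff_left inner_diff_right
          inner_commute[of "j v" "R t (j v)"] power2_eq_square algebra_simps)
    then show ?thesis
      using 1 unfolding has_vector_derivative_def h't h_def
      by (auto intro!: derivative_eq_intros ext simp: algebra_simps power2_eq_square)
  qed
  have h_eq: "h t = b (t *\<^sub>R Rv t (j v)) v" if "t \<ge> 0" for t
    using arg_cong[OF resolvent_eq[OF that, of "j v" v], of "\<lambda>r. t * r"]
    by (simp add: h_def b.scaleR_left power2_eq_square algebra_simps)
  have h_bounds: "0 \<le> h t" "h t \<le> b v v" if t: "t \<ge> 0" for t
  proof -
    define p where "p = t *\<^sub>R Rv t (j v)"
    have "b p \<phi> = t * ((j v - j p) \<bullet> j \<phi>)" for \<phi>
      using arg_cong[OF resolvent_eq[OF t, of "j v" \<phi>], of "\<lambda>r. t * r"]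
      by (simp add: p_def b.scaleR_left j.scaleR inner_diff_left algebra_simps)
    \<comment> \<open>The right-hand side becomes t times the squared norm of
      \<open>j (v - p)\<close>. So b(p,p) \<le> b(p,v), and expanding b(v-p, v-p) \<ge> 0 then
      yields b(p,v) \<le> b(v,v).\<close>
    from this[of "v - p"] have "b p (v - p) \<ge> 0"
      using t by (simp add: j.diff)
    then have pp: "b p p \<le> b p v" by (simp add: b.diff_right)
    moreover have "0 \<le> b (v - p) (v - p)" by (rule b_nonneg)
    then have "0 \<le> b v v - 2 * b p v + b p p"
      using sym[of v p] by (simp add: b.diff_right b.diff_left)
    ultimately show "0 \<le> h t" "h t \<le> b v v"
      using b_nonneg[of p] h_eq[OF t] unfolding p_def[symmetric] by linarith+
  qed
  have "(h' has_integral h hi - h lo) {lo..hi}"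
    by (rule fundamental_theorem_of_calculus[OF assms(3) D])
  then show ?thesis
    using h_bounds[of hi] h_bounds[of lo] assms unfolding h'_def by (simp add: has_integral_iff)
qed

section \<open>The square root integral: convergence, linearity and bounds\<close>

lemma continuous_on_sqrt_integrand:
  assumes "\<mu> \<ge> 0"
  shows "continuous_on {0<..} (\<lambda>t. t powr (-1/2) *\<^sub>R R (t + \<mu>) x)"
proof -
  have "continuous_on {0<..} (\<lambda>t. R (t + \<mu>) x)"
    by (rule continuous_on_compose2[OF continuous_on_resolvent[of x]])
      (use assms in \<open>auto intro!: continuous_intros\<close>)
  then show ?thesis by (intro continuous_intros) auto
qed

text \<open>The integrand is dominated by a multiple of the scalar integrand with shift \<mu> +
  \<delta>. The facts are obtained together so that one \<delta> serves all of them.\<close>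

lemma sqrt_integral_facts:
  obtains \<delta> where "\<delta> > 0"
    "\<And>t x. t \<ge> 0 \<Longrightarrow> norm (R t x) \<le> norm x / (t + \<delta>)"
    "\<And>\<mu> x. \<mu> \<ge> 0 \<Longrightarrow> (\<lambda>t. t powr (-1/2) *\<^sub>R R (t + \<mu>) x) integrable_on {0<..}"
    "\<And>\<mu> x. \<mu> \<ge> 0 \<Longrightarrow> norm (F \<mu> x) \<le> pi / sqrt (\<mu> + \<delta>) * norm x"
    "\<And>x. (\<lambda>n. integral {1 / real (Suc n)..real (Suc n)} (\<lambda>t. t powr (-1/2) *\<^sub>R R t x)) \<longlonglongrightarrow> F 0 x"
proof -
  obtain \<delta> where \<delta>: "\<delta> > 0" "\<And>t x. t \<ge> 0 \<Longrightarrow> (t + \<delta>) * norm (R t x) \<le> norm x"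
    using resolvent_bounds by metis
  have 1: "norm (R t x) \<le> norm x / (t + \<delta>)" if "t \<ge> 0" for t x
    using \<delta>(2)[OF that, of x] \<delta>(1) that by (simp add: field_simps)
  have g: "((\<lambda>t. norm x * (t powr (-1/2) / (t + (\<mu> + \<delta>)))) has_integral norm x * (pi / sqrt (\<mu> + \<delta>))) {0<..}"
    if "\<mu> \<ge> 0" for \<mu> x
    using that \<delta>(1) by (intro has_integral_mult_right integral_inverse_sqrt_over_shift) auto
  have dom: "norm (t powr (-1/2) *\<^sub>R R (t + \<mu>) x) \<le> norm x * (t powr (-1/2) / (t + (\<mu> + \<delta>)))"
    if "\<mu> \<ge> 0" "t > 0" for \<mu> t x
    using mult_left_mono[OF 1[of "t + \<mu>" x], of "t powr (-1/2)"] that by (simp add: add.assoc mult.commute)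
  have int: "(\<lambda>t. t powr (-1/2) *\<^sub>R R (t + \<mu>) x) integrable_on {0<..}" if "\<mu> \<ge> 0" for \<mu> x
    using integrable_on_greaterThan_dominated[OF continuous_on_sqrt_integrand[OF that]
        has_integral_integrable[OF g[OF that]] dom[OF that]] by simp
  have bd: "norm (F \<mu> x) \<le> pi / sqrt (\<mu> + \<delta>) * norm x" if "\<mu> \<ge> 0" for \<mu> x
  proof -
    have "norm (F \<mu> x) \<le> integral {0<..} (\<lambda>t. norm x * (t powr (-1/2) / (t + (\<mu> + \<delta>))))"
      unfolding resolvent_sqrt_integral_def
      by (rule integral_norm_bound_integral[OF int[OF that] has_integral_integrable[OF g[OF that]]])
        (use dom[OF that] in auto)
    also have "\<dots> = norm x * (pi / sqrt (\<mu> + \<delta>))" by (rule integral_unique[OF g[OF that]])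
    finally show ?thesis by (simp add: mult.commute)
  qed
  have lim: "(\<lambda>n. integral {1 / real (Suc n)..real (Suc n)} (\<lambda>t. t powr (-1/2) *\<^sub>R R t x)) \<longlonglongrightarrow> F 0 x" for x
    using integral_greaterThan_dominated_LIMSEQ[OF continuous_on_sqrt_integrand[of 0 x]
        has_integral_integrable[OF g[of 0 x]] dom[of 0 _ x]]
    by (simp add: resolvent_sqrt_integral_def)
  show thesis by (rule that[OF \<delta>(1) 1 int bd lim])
qed

lemma sqrt_integrand_integrable:
  "\<mu> \<ge> 0 \<Longrightarrow> (\<lambda>t. t powr (-1/2) *\<^sub>R R (t + \<mu>) x) integrable_on {0<..}"
  by (rule sqrt_integral_facts) auto

lemma F_linear_image:
  assumes "\<mu> \<ge> 0" "bounded_linear T"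
  shows "T (F \<mu> x) = integral {0<..} (\<lambda>t. t powr (-1/2) *\<^sub>R T (R (t + \<mu>) x))"
  using integral_linear[OF sqrt_integrand_integrable[OF assms(1)] assms(2), of x]
  by (simp add: resolvent_sqrt_integral_def o_def linear_scale[OF bounded_linear.linear[OF assms(2)]])

lemma F_add: "\<mu> \<ge> 0 \<Longrightarrow> F \<mu> (x + y) = F \<mu> x + F \<mu> y"
proof -
  assume \<mu>: "\<mu> \<ge> 0"
  have "F \<mu> (x + y) = integral {0<..}
      (\<lambda>t. t powr (-1/2) *\<^sub>R R (t + \<mu>) x + t powr (-1/2) *\<^sub>R R (t + \<mu>) y)"
    using \<mu> unfolding resolvent_sqrt_integral_def
    by (intro integral_cong) (simp add: Rv_add j.add scaleR_add_right)
  also have "\<dots> = F \<mu> x + F \<mu> y"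
    unfolding resolvent_sqrt_integral_def using \<mu> by (intro integral_add sqrt_integrand_integrable)
  finally show ?thesis .
qed

lemma F_scaleR: "\<mu> \<ge> 0 \<Longrightarrow> F \<mu> (r *\<^sub>R x) = r *\<^sub>R F \<mu> x"
proof -
  assume \<mu>: "\<mu> \<ge> 0"
  have "F \<mu> (r *\<^sub>R x) = integral {0<..} (\<lambda>t. r *\<^sub>R (t powr (-1/2) *\<^sub>R R (t + \<mu>) x))"
    using \<mu> unfolding resolvent_sqrt_integral_def
    by (intro integral_cong) (simp add: Rv_scaleR j.scaleR)
  also have "\<dots> = r *\<^sub>R F \<mu> x"
    unfolding resolvent_sqrt_integral_def by (rule integral_cmul)
  finally show ?thesis .
qed

lemma F_diff: "\<mu> \<ge> 0 \<Longrightarrow> F \<mu> (x - y) = F \<mu> x - F \<mu> y"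
  using F_add[of \<mu> x "- y"] F_scaleR[of \<mu> "- 1" y] by simp

lemma bounded_linear_F: "\<mu> \<ge> 0 \<Longrightarrow> bounded_linear (F \<mu>)"
proof -
  assume \<mu>: "\<mu> \<ge> 0"
  obtain \<delta> where "\<And>x. norm (F \<mu> x) \<le> pi / sqrt (\<mu> + \<delta>) * norm x"
    by (rule sqrt_integral_facts) (use \<mu> in blast)
  then show ?thesis
    by (intro bounded_linear_intro[of _ "pi / sqrt (\<mu> + \<delta>)"]) (simp_all add: \<mu> F_add F_scaleR mult.commute)
qed

lemma R_F_commute: "\<mu> \<ge> 0 \<Longrightarrow> s \<ge> 0 \<Longrightarrow> R s (F \<mu> x) = F \<mu> (R s x)"
  by (subst F_linear_image[OF _ bounded_linear_R])
    (auto intro!: integral_cong simp: resolvent_sqrt_integral_def resolvent_commute[of s])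

lemma F_adjoint: "\<mu> \<ge> 0 \<Longrightarrow> F \<mu> x \<bullet> y = x \<bullet> F' \<mu> y"
proof -
  assume \<mu>: "\<mu> \<ge> 0"
  interpret adj: coercive_form j "\<lambda>u v. b v u" by (rule flip)
  have "F \<mu> x \<bullet> y = integral {0<..} (\<lambda>t. t powr (-1/2) *\<^sub>R (R (t + \<mu>) x \<bullet> y))"
    by (rule F_linear_image[OF \<mu> bounded_linear_inner_left])
  also have "\<dots> = integral {0<..} (\<lambda>t. t powr (-1/2) *\<^sub>R (x \<bullet> R' (t + \<mu>) y))"
    using \<mu> by (intro integral_cong) (auto simp: resolvent_adjoint)
  also have "\<dots> = x \<bullet> F' \<mu> y"
    by (rule adj.F_linear_image[OF \<mu> bounded_linear_inner_right, symmetric])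
  finally show ?thesis .
qed

text \<open>\<open>\<integral> t\<^sup>-\<^sup>1\<^sup>/\<^sup>2 R(t) x dt\<close> is transformed into \<open>8 \<integral> t\<^sup>1\<^sup>/\<^sup>2 A R(t)\<^sup>3 x dt\<close> through the primitive
  \<open>2 t\<^sup>1\<^sup>/\<^sup>2 R(t) x - 4 t\<^sup>3\<^sup>/\<^sup>2 R(t)\<^sup>2 x\<close> of the difference; the factors \<open>A R(t)\<^sup>2 x\<close> and
  \<open>A\<^sup>* R(t)\<^sup>* \<phi>\<close>, where \<open>y = A\<^sup>* \<phi>\<close>, then carry quadratic estimates.\<close>

lemma truncated_sqrt_integral_le:
  assumes L: "\<And>lo hi v. 0 \<le> lo \<Longrightarrow> lo \<le> hi \<Longrightarrow>
      integral {lo..hi} (\<lambda>t. (norm (j v - t *\<^sub>R R' t (j v)))\<^sup>2) \<le> L * (norm v)\<^sup>2"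
    and "0 < lo" "lo \<le> hi" "r > 0"
  shows "integral {lo..hi} (\<lambda>t. t powr (-1/2) *\<^sub>R R t x) \<bullet> y
    \<le> 6 * sqrt lo * norm (R lo x) * norm y + 6 * sqrt hi * norm (R hi x) * norm y
      + 2 * r * (norm x)\<^sup>2 + 4 * L * (norm (Rv' 0 y))\<^sup>2 / r"
proof -
  interpret adj: coercive_form j "\<lambda>u v. b v u" by (rule flip)
  define g where "g t = R t x - t *\<^sub>R R t (R t x)" for t
  \<comment> \<open>The adjoint factor at \<open>\<phi> = Rv' 0 y\<close>, in the shape to which the
    hypothesis on \<open>L\<close> applies. It equals \<open>R' t y\<close>, which is what remains
    after one resolvent is moved from \<open>R t (g t)\<close> to \<open>y\<close>.\<close>
  define k where "k t = R' 0 y - t *\<^sub>R R' t (R' 0 y)" for t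
  \<comment> \<open>Integration by parts with primitive 2 sqrt t of the weight leaves twice the
    integral of \<open>sqrt t R(t)^2 x\<close>. A second one, with t R(t) = 1 - A R(t), turns that
    integral into 4 times the one with \<open>A R(t)^3 x\<close>, whence the 8.\<close>
  define G where "G t = (2 * sqrt t) *\<^sub>R R t x - (4 * (t * sqrt t)) *\<^sub>R R t (R t x)" for t
  have sub: "{lo..hi} \<subseteq> {0..}" "{lo..hi} \<subseteq> {0<..}" using assms by auto
  have powr: "t powr (-1/2) = 1 / sqrt t" if "t > 0" for t :: real
    using that powr_minus[of t "1/2"] powr_half_sqrt[of t] by (simp add: inverse_eq_divide)
  have kR: "k t = R' t y" if "t \<ge> 0" for t
    using adj.resolvent_identity[of 0 t y] adj.resolvent_commute[of 0 t y] that
    by (simp add: k_def algebra_simps)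
  have cont [continuous_intros]: "continuous_on {lo..hi} (\<lambda>t. R t x)" "continuous_on {lo..hi} (\<lambda>t. R t (R t x))"
    "continuous_on {lo..hi} (\<lambda>t. R' t z)" for z
    using continuous_on_subset[OF _ sub(1)] continuous_on_resolvent continuous_on_resolvent_square
      adj.continuous_on_resolvent by blast+
  have contp [continuous_intros]: "continuous_on {lo..hi} (\<lambda>t. t powr (-1/2))"
    using sub(2) by (intro continuous_intros) auto
  have D: "(G has_vector_derivative t powr (-1/2) *\<^sub>R R t x - (8 * sqrt t) *\<^sub>R R t (g t)) (at t within {lo..hi})"
    if "t \<in> {lo..hi}" for t
  proof -
    have t: "t > 0" using that assms by simp
    note 1 = has_vector_derivative_within_Icc_of_nonneg[OF resolvent_has_vector_derivative less_imp_le, OF less_imp_le, OF t assms(2)]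
      has_vector_derivative_within_Icc_of_nonneg[OF resolvent_square_has_vector_derivative less_imp_le, OF less_imp_le, OF t assms(2)]
    have 2: "((\<lambda>t. 2 * sqrt t) has_real_derivative 1 / sqrt t) (at t within {lo..hi})"
      using t by (auto intro!: derivative_eq_intros simp: field_simps)
    have 3: "((\<lambda>t. 4 * (t * sqrt t)) has_real_derivative 6 * sqrt t) (at t within {lo..hi})"
      using t by (auto intro!: derivative_eq_intros simp: field_simps)
    have "(G has_vector_derivative
        ((2 * sqrt t) *\<^sub>R (- R t (R t x)) + (1 / sqrt t) *\<^sub>R R t x)
        - ((4 * (t * sqrt t)) *\<^sub>R (- 2 *\<^sub>R R t (R t (R t x))) + (6 * sqrt t) *\<^sub>R R t (R t x)))
        (at t within {lo..hi})"
      unfolding G_def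
      by (intro has_vector_derivative_diff has_vector_derivative_scaleR 1 2 3)
    moreover have "((2 * sqrt t) *\<^sub>R (- R t (R t x)) + (1 / sqrt t) *\<^sub>R R t x)
        - ((4 * (t * sqrt t)) *\<^sub>R (- 2 *\<^sub>R R t (R t (R t x))) + (6 * sqrt t) *\<^sub>R R t (R t x))
        = t powr (-1/2) *\<^sub>R R t x - (8 * sqrt t) *\<^sub>R R t (g t)"
      unfolding powr[OF t] using t
      by (simp add: g_def Rv_diff Rv_scaleR j.diff j.scaleR algebra_simps flip: scaleR_add_left)
    ultimately show ?thesis by simp
  qed
  have i1: "((\<lambda>t. (t powr (-1/2) *\<^sub>R R t x - (8 * sqrt t) *\<^sub>R R t (g t)) \<bullet> y) has_integral (G hi - G lo) \<bullet> y) {lo..hi}"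
    using has_integral_linear[OF fundamental_theorem_of_calculus[OF assms(3) D] bounded_linear_inner_left[of y]]
    by (simp add: o_def)
  have i2: "((\<lambda>t. (t powr (-1/2) *\<^sub>R R t x) \<bullet> y) has_integral
      integral {lo..hi} (\<lambda>t. t powr (-1/2) *\<^sub>R R t x) \<bullet> y) {lo..hi}"
  proof -
    have "(\<lambda>t. t powr (-1/2) *\<^sub>R R t x) integrable_on {lo..hi}"
      by (intro integrable_continuous_real continuous_intros)
    from has_integral_linear[OF integrable_integral[OF this] bounded_linear_inner_left[of y]]
    show ?thesis by (simp add: o_def)
  qed
  have "((\<lambda>t. 8 * sqrt t * (R t (g t) \<bullet> y)) has_integral
      integral {lo..hi} (\<lambda>t. t powr (-1/2) *\<^sub>R R t x) \<bullet> y - (G hi - G lo) \<bullet> y) {lo..hi}"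
    using has_integral_diff[OF i2 i1] by (simp add: inner_diff_left)
  moreover have "R t (g t) \<bullet> y = g t \<bullet> k t" if "t \<in> {lo..hi}" for t
    using that assms by (simp add: resolvent_adjoint kR)
  ultimately have i3: "((\<lambda>t. 8 * sqrt t * (g t \<bullet> k t)) has_integral
      integral {lo..hi} (\<lambda>t. t powr (-1/2) *\<^sub>R R t x) \<bullet> y - (G hi - G lo) \<bullet> y) {lo..hi}"
    by (subst (asm) has_integral_cong) auto
  have cg [continuous_intros]: "continuous_on {lo..hi} g" "continuous_on {lo..hi} k"
    unfolding g_def k_def by (intro continuous_intros)+
  have iq: "((\<lambda>t. (2 * r) * (2 * t * (norm (g t))\<^sup>2) + 4 / r * (norm (k t))\<^sup>2) has_integral
      (2 * r) * integral {lo..hi} (\<lambda>t. 2 * t * (norm (g t))\<^sup>2) + 4 / r * integral {lo..hi} (\<lambda>t. (norm (k t))\<^sup>2)) {lo..hi}"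
    by (intro has_integral_add has_integral_mult_right integrable_integral integrable_continuous_real continuous_intros)
  have "integral {lo..hi} (\<lambda>t. t powr (-1/2) *\<^sub>R R t x) \<bullet> y - (G hi - G lo) \<bullet> y
      \<le> (2 * r) * integral {lo..hi} (\<lambda>t. 2 * t * (norm (g t))\<^sup>2) + 4 / r * integral {lo..hi} (\<lambda>t. (norm (k t))\<^sup>2)"
  proof (rule has_integral_le[OF i3 iq])
    fix t assume "t \<in> {lo..hi}"
    then have t: "t > 0" using assms by simp
    define a c where "a = sqrt t * norm (g t)" and "c = norm (k t)"
    have "8 * sqrt t * (g t \<bullet> k t) \<le> 8 * sqrt t * (norm (g t) * norm (k t))"
      using t by (intro mult_left_mono norm_cauchy_schwarz) auto
    also have "\<dots> = 8 * (a * c)" by (simp add: a_def c_def)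
    \<comment> \<open>Weighted arithmetic-geometric mean inequality. The free weight
      \<open>r\<close> is optimised only after the integration.\<close>
    also have "\<dots> \<le> 4 * r * a\<^sup>2 + 4 / r * c\<^sup>2"
    proof -
      have "0 \<le> 4 / r * (r * a - c)\<^sup>2" using assms(4) by simp
      also have "\<dots> = 4 * r * a\<^sup>2 + 4 / r * c\<^sup>2 - 8 * (a * c)"
        using assms(4) by (simp add: field_simps power2_eq_square)
      finally show ?thesis by simp
    qed
    also have "a\<^sup>2 = t * (norm (g t))\<^sup>2" using t by (simp add: a_def power_mult_distrib)
    finally show "8 * sqrt t * (g t \<bullet> k t) \<le> (2 * r) * (2 * t * (norm (g t))\<^sup>2) + 4 / r * (norm (k t))\<^sup>2"
      by (simp add: c_def algebra_simps)
  qed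
  also have "\<dots> \<le> (2 * r) * (norm x)\<^sup>2 + 4 / r * (L * (norm (Rv' 0 y))\<^sup>2)"
    using assms(4) integral_quadratic_estimate_le[of lo hi x] L[of lo hi "Rv' 0 y"] assms
    unfolding g_def k_def by (intro add_mono mult_left_mono) auto
  finally have main: "integral {lo..hi} (\<lambda>t. t powr (-1/2) *\<^sub>R R t x) \<bullet> y - (G hi - G lo) \<bullet> y
      \<le> 2 * r * (norm x)\<^sup>2 + 4 * L * (norm (Rv' 0 y))\<^sup>2 / r"
    by (simp add: mult_ac)
  \<comment> \<open>6 = 2 + 4, since \<open>t R(t)\<close> is a contraction.\<close>
  have Gb: "\<bar>G t \<bullet> y\<bar> \<le> 6 * sqrt t * norm (R t x) * norm y" if "t \<ge> 0" for t
  proof -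
    have "norm (G t) \<le> norm ((2 * sqrt t) *\<^sub>R R t x) + norm ((4 * (t * sqrt t)) *\<^sub>R R t (R t x))"
      unfolding G_def by (rule norm_triangle_ineq4)
    also have "\<dots> = 2 * sqrt t * norm (R t x) + 4 * sqrt t * norm (t *\<^sub>R R t (R t x))"
      using that by (simp add: abs_mult)
    also have "\<dots> \<le> 2 * sqrt t * norm (R t x) + 4 * sqrt t * norm (R t x)"
      using that by (intro add_left_mono mult_left_mono norm_scaled_resolvent_le) auto
    finally have "norm (G t) \<le> 6 * sqrt t * norm (R t x)" by simp
    from mult_right_mono[OF this norm_ge_zero[of y]] show ?thesis
      using Cauchy_Schwarz_ineq2[of "G t" y] by linarith
  qed
  show ?thesis
    using main Gb[of lo] Gb[of hi] assms by (simp add: inner_diff_left abs_le_iff)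
qed

text \<open>The boundary terms are of size sqrt t / (t + \<delta>), which vanishes at both ends, so
  only the two quadratic estimates survive the limit. Optimising the weight \<open>r\<close> turns
  their sum into a product, and replacing x by -x gives the absolute value.\<close>

lemma F_0_inner_le:
  assumes L: "\<And>lo hi v. 0 \<le> lo \<Longrightarrow> lo \<le> hi \<Longrightarrow>
      integral {lo..hi} (\<lambda>t. (norm (j v - t *\<^sub>R R' t (j v)))\<^sup>2) \<le> L * (norm v)\<^sup>2" and "L \<ge> 0"
  shows "\<bar>F 0 x \<bullet> y\<bar> \<le> (2 + 4 * L) * norm x * norm (Rv' 0 y)"
proof -
  have le: "F 0 x \<bullet> y \<le> (2 + 4 * L) * norm x * norm (Rv' 0 y)" for x
  proof (rule le_of_scaled_le)
    fix r :: real assume r: "r > 0"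
    obtain \<delta> where \<delta>: "\<delta> > 0"
      "\<And>t x. t \<ge> 0 \<Longrightarrow> norm (R t x) \<le> norm x / (t + \<delta>)"
      "\<And>x. (\<lambda>n. integral {1 / real (Suc n)..real (Suc n)} (\<lambda>t. t powr (-1/2) *\<^sub>R R t x)) \<longlonglongrightarrow> F 0 x"
      by (rule sqrt_integral_facts) blast
    define c where "c = 2 * r * (norm x)\<^sup>2 + 4 * L * (norm (Rv' 0 y))\<^sup>2 / r"
    define e where "e t = 6 * (sqrt t / (t + \<delta>)) * (norm x * norm y)" for t
    have e: "6 * sqrt t * norm (R t x) * norm y \<le> e t" if "t \<ge> 0" for t
      using mult_left_mono[OF \<delta>(2)[OF that, of x], of "6 * sqrt t * norm y"] that
      by (simp add: e_def mult_ac)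
    have "(e \<longlongrightarrow> 6 * (sqrt 0 / (0 + \<delta>)) * (norm x * norm y)) (at 0)"
      unfolding e_def using \<delta>(1) by (intro tendsto_intros) auto
    moreover have "filterlim (\<lambda>n. 1 / real (Suc n)) (at 0) sequentially"
      unfolding filterlim_at using LIMSEQ_Suc[OF lim_1_over_n] by simp
    ultimately have "(\<lambda>n. e (1 / real (Suc n))) \<longlonglongrightarrow> 6 * (sqrt 0 / (0 + \<delta>)) * (norm x * norm y)"
      by (rule filterlim_compose)
    then have e0: "(\<lambda>n. e (1 / real (Suc n))) \<longlonglongrightarrow> 0" by simp
    have "((\<lambda>t. sqrt t / (t + \<delta>)) \<longlongrightarrow> 0) at_top"
    proof (rule Lim_null_comparison)
      show "\<forall>\<^sub>F t in at_top. norm (sqrt t / (t + \<delta>)) \<le> 1 / sqrt t"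
        using eventually_gt_at_top[of 0]
        by eventually_elim (use \<delta>(1) in \<open>simp add: divide_simps\<close>)
      show "((\<lambda>t::real. 1 / sqrt t) \<longlongrightarrow> 0) at_top"
        by (rule tendsto_divide_0[OF tendsto_const filterlim_at_top_imp_at_infinity[OF sqrt_at_top]])
    qed
    then have "(e \<longlongrightarrow> 6 * 0 * (norm x * norm y)) at_top"
      unfolding e_def by (intro tendsto_intros)
    then have e1: "(\<lambda>n. e (real (Suc n))) \<longlonglongrightarrow> 0"
      using filterlim_compose[OF _ filterlim_compose[OF filterlim_real_sequentially filterlim_Suc]] by fastforce
    show "F 0 x \<bullet> y \<le> 2 * r * (norm x)\<^sup>2 + 4 * L * (norm (Rv' 0 y))\<^sup>2 / r"
    proof (rule LIMSEQ_le)
      show "(\<lambda>n. integral {1 / real (Suc n)..real (Suc n)} (\<lambda>t. t powr (-1/2) *\<^sub>R R t x) \<bullet> y) \<longlonglongrightarrow> F 0 x \<bullet> y"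
        by (intro tendsto_intros \<delta>(3))
      have "(\<lambda>n. e (1 / real (Suc n)) + e (real (Suc n)) + c) \<longlonglongrightarrow> 0 + 0 + c"
        by (intro tendsto_intros e0 e1)
      then show "(\<lambda>n. e (1 / real (Suc n)) + e (real (Suc n)) + c) \<longlonglongrightarrow> 2 * r * (norm x)\<^sup>2 + 4 * L * (norm (Rv' 0 y))\<^sup>2 / r"
        by (simp add: c_def)
      have "integral {1 / real (Suc n)..real (Suc n)} (\<lambda>t. t powr (-1/2) *\<^sub>R R t x) \<bullet> y
          \<le> e (1 / real (Suc n)) + e (real (Suc n)) + c" for n
        using truncated_sqrt_integral_le[OF L _ _ r, of "1 / real (Suc n)" "real (Suc n)" x y]
          e[of "1 / real (Suc n)"] e[of "real (Suc n)"] unfolding c_def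
        by (simp add: field_simps)
      then show "\<exists>N. \<forall>n\<ge>N. integral {1 / real (Suc n)..real (Suc n)} (\<lambda>t. t powr (-1/2) *\<^sub>R R t x) \<bullet> y
          \<le> e (1 / real (Suc n)) + e (real (Suc n)) + c" by blast
    qed
  qed (use assms(2) in auto)
  show ?thesis
    using le[of x] le[of "- x"] F_scaleR[of 0 "- 1" x] by (simp add: abs_le_iff)
qed


section \<open>Dependence of \<open>F \<mu>\<close> on \<mu> and the square of
  \<open>F 0\<close>\<close>

lemma resolvent_identity_0: "s \<ge> 0 \<Longrightarrow> s *\<^sub>R R s (R 0 z) = R 0 z - R s z"
  using resolvent_identity[of s 0 z] by (simp add: algebra_simps)

lemma closure_range_Rv: "closure (range (Rv 0)) = UNIV"
proof -
  have "v \<in> closure (range (Rv 0))" for v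
    unfolding closure_approachable dist_norm using resolvent_range_dense[of _ v] by blast
  then show ?thesis by blast
qed

lemma closure_range_R: "closure (range (R 0)) = UNIV"
proof -
  have "j ` closure (range (Rv 0)) \<subseteq> closure (range (R 0))"
    by (rule image_closure_subset)
      (auto intro!: linear_continuous_on j_lin closure_subset[THEN subsetD])
  then have "range j \<subseteq> closure (range (R 0))" by (simp add: closure_range_Rv)
  then have "closure (range j) \<subseteq> closure (range (R 0))" by (metis closure_closure closure_mono)
  then show ?thesis using j_dense by auto
qed

text \<open>The difference of the two sides has the primitive \<open>\<surd>t R(t + \<mu>) R(\<mu>) x\<close>, which vanishes at
  both ends.\<close>

lemma has_integral_resolvent_square:
  assumes \<mu>: "\<mu> \<ge> 0"
  shows "((\<lambda>t. t powr (-1/2) *\<^sub>R R (t + \<mu>) (R (t + \<mu>) x)) has_integral (1/2) *\<^sub>R F \<mu> (R \<mu> x)) {0<..}"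
proof -
  obtain \<delta> where \<delta>: "\<delta> > 0" "\<And>t x. t \<ge> 0 \<Longrightarrow> norm (R t x) \<le> norm x / (t + \<delta>)"
    by (rule sqrt_integral_facts) blast
  define y where "y = R \<mu> x"
  define f where "f t = t powr (-1/2) *\<^sub>R (R (t + \<mu>) (R (t + \<mu>) x) - (1/2) *\<^sub>R R (t + \<mu>) y)" for t
  define H where "H t = sqrt t *\<^sub>R R (t + \<mu>) y" for t
  define C where "C = norm x / \<delta> + norm y"
  have C: "C \<ge> 0" using \<delta>(1) by (simp add: C_def)
  have powr: "t powr (-1/2) = 1 / sqrt t" if "t > 0" for t :: real
    using that powr_minus[of t "1/2"] powr_half_sqrt[of t] by (simp add: inverse_eq_divide)
  have contR: "continuous_on {0<..} (\<lambda>t. R (t + \<mu>) z)" "continuous_on {0<..} (\<lambda>t. R (t + \<mu>) (R (t + \<mu>) z))" for z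
    by (rule continuous_on_compose2[OF continuous_on_resolvent[of z]] continuous_on_compose2[OF continuous_on_resolvent_square[of z]];
        use \<mu> in \<open>auto intro!: continuous_intros\<close>)+
  have cont: "continuous_on {0<..} f"
    unfolding f_def by (intro continuous_intros contR) auto
  have g: "((\<lambda>t. C * (t powr (-1/2) / (t + \<delta>))) has_integral C * (pi / sqrt \<delta>)) {0<..}"
    using \<delta>(1) by (intro has_integral_mult_right integral_inverse_sqrt_over_shift)
  have Rle: "norm (R (t + \<mu>) z) \<le> norm z / (t + \<delta>)" if "t > 0" for t z
  proof -
    have "norm (R (t + \<mu>) z) \<le> norm z / (t + \<mu> + \<delta>)" using \<delta>(2)[of "t + \<mu>" z] that \<mu> by simp
    also have "\<dots> \<le> norm z / (t + \<delta>)" using that \<mu> \<delta>(1) by (intro divide_left_mono) auto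
    finally show ?thesis .
  qed
  have dom: "norm (f t) \<le> C * (t powr (-1/2) / (t + \<delta>))" if t: "t > 0" for t
  proof -
    have "norm (R (t + \<mu>) x) \<le> norm x / (t + \<delta>)" by (rule Rle[OF t])
    also have "\<dots> \<le> norm x / \<delta>" using t \<delta>(1) by (intro divide_left_mono) auto
    finally have "norm (R (t + \<mu>) (R (t + \<mu>) x)) \<le> (norm x / \<delta>) / (t + \<delta>)"
      using Rle[OF t, of "R (t + \<mu>) x"] t \<delta>(1)
      by (meson divide_right_mono add_pos_pos less_imp_le order_trans)
    moreover have "norm ((1/2) *\<^sub>R R (t + \<mu>) y) \<le> norm y / (t + \<delta>)"
      by (rule order_trans[OF _ Rle[OF t]]) simp
    moreover have "C / (t + \<delta>) = norm x / \<delta> / (t + \<delta>) + norm y / (t + \<delta>)"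
      by (simp add: C_def add_divide_distrib)
    ultimately have "norm (R (t + \<mu>) (R (t + \<mu>) x) - (1/2) *\<^sub>R R (t + \<mu>) y) \<le> C / (t + \<delta>)"
      using norm_triangle_ineq4[of "R (t + \<mu>) (R (t + \<mu>) x)" "(1/2) *\<^sub>R R (t + \<mu>) y"]
      by linarith
    from mult_left_mono[OF this, of "t powr (-1/2)"] show ?thesis
      unfolding f_def norm_scaleR by (simp add: mult.commute)
  qed
  have D: "(H has_vector_derivative f t) (at t within {lo..hi})" if lo: "0 < lo" and t: "t \<in> {lo..hi}" for t lo hi
  proof -
    have t0: "t > 0" using lo t by simp
    have "((\<lambda>t. t + \<mu>) has_vector_derivative 1) (at t within {lo..hi})"
      by (auto intro!: derivative_eq_intros simp: has_vector_derivative_def)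
    moreover have "((\<lambda>s. R s y) has_vector_derivative - R (t + \<mu>) (R (t + \<mu>) y)) (at (t + \<mu>) within (\<lambda>t. t + \<mu>) ` {lo..hi})"
      by (rule has_vector_derivative_within_subset[OF resolvent_has_vector_derivative]) (use t0 \<mu> lo in auto)
    ultimately have 1: "((\<lambda>t. R (t + \<mu>) y) has_vector_derivative - R (t + \<mu>) (R (t + \<mu>) y)) (at t within {lo..hi})"
      using vector_diff_chain_within[of "\<lambda>t. t + \<mu>" 1 t "{lo..hi}" "\<lambda>s. R s y"] by (simp add: o_def)
    have 2: "(sqrt has_real_derivative 1 / (2 * sqrt t)) (at t within {lo..hi})"
      using t0 by (auto intro!: derivative_eq_intros simp: field_simps)
    have "(H has_vector_derivative sqrt t *\<^sub>R (- R (t + \<mu>) (R (t + \<mu>) y)) + (1 / (2 * sqrt t)) *\<^sub>R R (t + \<mu>) y)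
        (at t within {lo..hi})"
      unfolding H_def by (intro has_vector_derivative_scaleR 1 2)
    moreover have "sqrt t *\<^sub>R (- R (t + \<mu>) (R (t + \<mu>) y)) + (1 / (2 * sqrt t)) *\<^sub>R R (t + \<mu>) y = f t"
    proof -
      \<comment> \<open>The resolvent identity between \<mu> and t + \<mu>. It eliminates the factor
        t from the derivative of \<open>H\<close> and leaves the integrand \<open>f\<close>.\<close>
      have "t *\<^sub>R R (t + \<mu>) y = y - R (t + \<mu>) x"
        using resolvent_identity[of \<mu> "t + \<mu>" x] resolvent_commute[of \<mu> "t + \<mu>" x] \<mu> t0 by (simp add: y_def)
      then have "R (t + \<mu>) (t *\<^sub>R R (t + \<mu>) y) = R (t + \<mu>) y - R (t + \<mu>) (R (t + \<mu>) x)"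
        using \<mu> t0 by (simp add: Rv_diff j.diff)
      then have e: "t *\<^sub>R R (t + \<mu>) (R (t + \<mu>) y) = R (t + \<mu>) y - R (t + \<mu>) (R (t + \<mu>) x)"
        using \<mu> t0 by (simp add: Rv_scaleR j.scaleR)
      have "sqrt t *\<^sub>R R (t + \<mu>) (R (t + \<mu>) y) = (1 / sqrt t) *\<^sub>R (t *\<^sub>R R (t + \<mu>) (R (t + \<mu>) y))"
        using t0 by (simp add: real_div_sqrt)
      also have "\<dots> = (1 / sqrt t) *\<^sub>R (R (t + \<mu>) y - R (t + \<mu>) (R (t + \<mu>) x))" unfolding e ..
      finally show ?thesis
        unfolding f_def powr[OF t0] by (simp add: algebra_simps flip: scaleR_add_left)
    qed
    ultimately show ?thesis by simp
  qed
  have fint: "f integrable_on {0<..}"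
    by (rule integrable_on_greaterThan_dominated[OF cont has_integral_integrable[OF g] dom])
  have lim: "(\<lambda>n. integral {1 / real (Suc n)..real (Suc n)} f) \<longlonglongrightarrow> integral {0<..} f"
    by (rule integral_greaterThan_dominated_LIMSEQ[OF cont has_integral_integrable[OF g] dom])
  have I: "integral {1 / real (Suc n)..real (Suc n)} f = H (real (Suc n)) - H (1 / real (Suc n))" for n
    by (rule integral_unique[OF fundamental_theorem_of_calculus[OF _ D]]) (auto simp: field_simps)
  \<comment> \<open>The first bound serves t near 0, the second t near infinity.\<close>
  have Hle: "norm (H t) \<le> norm y / \<delta> * sqrt t" "norm (H t) \<le> norm y * (1 / sqrt t)" if t: "t > 0" for t
  proof -
    have le: "norm (R (t + \<mu>) y) \<le> norm y / \<delta>" "norm (R (t + \<mu>) y) \<le> norm y / t"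
      using Rle[OF t, of y] t \<delta>(1) by (auto elim!: order_trans intro!: divide_left_mono)
    from mult_left_mono[OF le(1), of "sqrt t"] show "norm (H t) \<le> norm y / \<delta> * sqrt t"
      using t unfolding H_def norm_scaleR by (simp add: mult.commute)
    have "sqrt t * (norm y / t) = norm y * (1 / sqrt t)"
      using t by (simp add: real_div_sqrt field_simps)
    with mult_left_mono[OF le(2), of "sqrt t"] show "norm (H t) \<le> norm y * (1 / sqrt t)"
      using t unfolding H_def norm_scaleR by simp
  qed
  have lo: "(\<lambda>n. 1 / real (Suc n)) \<longlonglongrightarrow> 0" by (rule LIMSEQ_Suc[OF lim_1_over_n])
  have "(\<lambda>n. H (1 / real (Suc n))) \<longlonglongrightarrow> 0"
  proof (rule Lim_null_comparison)
    show "\<forall>\<^sub>F n in sequentially. norm (H (1 / real (Suc n))) \<le> norm y / \<delta> * sqrt (1 / real (Suc n))"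
      by (intro always_eventually allI Hle) simp
    have "(\<lambda>n. norm y / \<delta> * sqrt (1 / real (Suc n))) \<longlonglongrightarrow> norm y / \<delta> * sqrt 0"
      by (intro tendsto_intros lo)
    then show "(\<lambda>n. norm y / \<delta> * sqrt (1 / real (Suc n))) \<longlonglongrightarrow> 0" by simp
  qed
  moreover have "(\<lambda>n. H (real (Suc n))) \<longlonglongrightarrow> 0"
  proof (rule Lim_null_comparison)
    show "\<forall>\<^sub>F n in sequentially. norm (H (real (Suc n))) \<le> norm y * sqrt (1 / real (Suc n))"
      by (intro always_eventually allI) (use Hle(2) in \<open>simp add: real_sqrt_divide\<close>)
    have "(\<lambda>n. norm y * sqrt (1 / real (Suc n))) \<longlonglongrightarrow> norm y * sqrt 0"
      by (intro tendsto_intros lo)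
    then show "(\<lambda>n. norm y * sqrt (1 / real (Suc n))) \<longlonglongrightarrow> 0" by simp
  qed
  ultimately have "(\<lambda>n. integral {1 / real (Suc n)..real (Suc n)} f) \<longlonglongrightarrow> 0"
    unfolding I using tendsto_diff by fastforce
  then have "(f has_integral 0) {0<..}"
    using fint LIMSEQ_unique[OF lim] by (simp add: has_integral_iff)
  moreover have "((\<lambda>t. (1/2) *\<^sub>R (t powr (-1/2) *\<^sub>R R (t + \<mu>) y)) has_integral (1/2) *\<^sub>R F \<mu> y) {0<..}"
    unfolding resolvent_sqrt_integral_def
    by (intro has_integral_cmul integrable_integral sqrt_integrand_integrable \<mu>)
  ultimately have "((\<lambda>t. f t + (1/2) *\<^sub>R (t powr (-1/2) *\<^sub>R R (t + \<mu>) y)) has_integral 0 + (1/2) *\<^sub>R F \<mu> y) {0<..}"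
    by (rule has_integral_add)
  then show ?thesis by (simp add: f_def y_def scaleR_diff_right)
qed

text \<open>Differentiation under the integral sign: the remainder of the resolvent is exact and
  quadratic, and the integral of \<open>R(t + \<mu>)^2 x\<close> is already known to be half of
  \<open>F \<mu> (R \<mu> x)\<close>.\<close>

lemma F_has_vector_derivative:
  assumes \<mu>: "\<mu> \<ge> 0"
  shows "((\<lambda>\<mu>. F \<mu> x) has_vector_derivative - (1/2) *\<^sub>R F \<mu> (R \<mu> x)) (at \<mu> within {0..})"
proof -
  obtain \<delta> where \<delta>: "\<delta> > 0" "\<And>t x. t \<ge> 0 \<Longrightarrow> norm (R t x) \<le> norm x / (t + \<delta>)"
    by (rule sqrt_integral_facts) blast
  have le: "norm (R t z) \<le> norm z / \<delta>" if "t \<ge> 0" for t z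
    using \<delta>(2)[OF that, of z] divide_left_mono[of \<delta> "t + \<delta>" "norm z"] that \<delta>(1) by simp
  \<comment> \<open>Two of the three resolvents in the remainder are estimated by 1/\<delta>, the
    third by 1/(t + \<delta>) for integrability.\<close>
  define C where "C = norm x / \<delta> / \<delta> * (pi / sqrt \<delta>)"
  have err: "norm (F \<nu> x - F \<mu> x - (\<nu> - \<mu>) *\<^sub>R (- (1/2) *\<^sub>R F \<mu> (R \<mu> x))) \<le> C * \<bar>\<nu> - \<mu>\<bar>\<^sup>2"
    if \<nu>: "\<nu> \<ge> 0" for \<nu>
  proof -
    define k where "k t = t powr (-1/2) *\<^sub>R R (t + \<nu>) x - t powr (-1/2) *\<^sub>R R (t + \<mu>) x
        + (\<nu> - \<mu>) *\<^sub>R (t powr (-1/2) *\<^sub>R R (t + \<mu>) (R (t + \<mu>) x))" for t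
    have k: "(k has_integral F \<nu> x - F \<mu> x + (\<nu> - \<mu>) *\<^sub>R ((1/2) *\<^sub>R F \<mu> (R \<mu> x))) {0<..}"
      unfolding k_def resolvent_sqrt_integral_def[of j b _ x]
      by (intro has_integral_add has_integral_diff has_integral_cmul has_integral_resolvent_square
          integrable_integral sqrt_integrand_integrable \<mu> \<nu>)
    have g: "((\<lambda>t. (norm x / \<delta> / \<delta> * \<bar>\<nu> - \<mu>\<bar>\<^sup>2) * (t powr (-1/2) / (t + \<delta>))) has_integral
        (norm x / \<delta> / \<delta> * \<bar>\<nu> - \<mu>\<bar>\<^sup>2) * (pi / sqrt \<delta>)) {0<..}"
      using \<delta>(1) by (intro has_integral_mult_right integral_inverse_sqrt_over_shift)
    have "norm (F \<nu> x - F \<mu> x + (\<nu> - \<mu>) *\<^sub>R ((1/2) *\<^sub>R F \<mu> (R \<mu> x)))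
        \<le> (norm x / \<delta> / \<delta> * \<bar>\<nu> - \<mu>\<bar>\<^sup>2) * (pi / sqrt \<delta>)"
      unfolding integral_unique[OF k, symmetric] integral_unique[OF g, symmetric]
    proof (rule integral_norm_bound_integral[OF has_integral_integrable[OF k] has_integral_integrable[OF g]])
      fix t :: real assume "t \<in> {0<..}"
      then have t: "t > 0" by simp
      have nn: "t + \<mu> \<ge> 0" "t + \<nu> \<ge> 0" using t \<mu> \<nu> by auto
      let ?y = "R (t + \<mu>) x"
      have "R (t + \<nu>) x - R (t + \<mu>) x + (\<nu> - \<mu>) *\<^sub>R R (t + \<mu>) ?y
          = (\<nu> - \<mu>) *\<^sub>R (R (t + \<mu>) ?y - R (t + \<nu>) ?y)"
        unfolding resolvent_identity[OF nn(2,1)] by (simp add: algebra_simps)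
      also have "\<dots> = (\<nu> - \<mu>)\<^sup>2 *\<^sub>R R (t + \<nu>) (R (t + \<mu>) ?y)"
        unfolding resolvent_identity[OF nn] resolvent_commute[OF nn] by (simp add: power2_eq_square)
      finally have e: "R (t + \<nu>) x - R (t + \<mu>) x + (\<nu> - \<mu>) *\<^sub>R R (t + \<mu>) ?y
          = (\<nu> - \<mu>)\<^sup>2 *\<^sub>R R (t + \<nu>) (R (t + \<mu>) ?y)" .
      have "norm (R (t + \<nu>) (R (t + \<mu>) ?y)) \<le> norm (R (t + \<mu>) ?y) / (t + \<nu> + \<delta>)"
        by (rule \<delta>(2)[OF nn(2)])
      also have "\<dots> \<le> norm (R (t + \<mu>) ?y) / (t + \<delta>)"
        using t \<nu> \<delta>(1) by (intro divide_left_mono) auto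
      also have "\<dots> \<le> (norm x / \<delta> / \<delta>) / (t + \<delta>)"
      proof (rule divide_right_mono)
        have "norm (R (t + \<mu>) ?y) \<le> norm ?y / \<delta>" by (rule le[OF nn(1)])
        also have "\<dots> \<le> norm x / \<delta> / \<delta>" using le[OF nn(1), of x] \<delta>(1) by (intro divide_right_mono) auto
        finally show "norm (R (t + \<mu>) ?y) \<le> norm x / \<delta> / \<delta>" .
      qed (use t \<delta>(1) in auto)
      finally have "norm (R (t + \<nu>) (R (t + \<mu>) ?y)) \<le> (norm x / \<delta> / \<delta>) / (t + \<delta>)" .
      from mult_left_mono[OF this, of "t powr (-1/2) * (\<nu> - \<mu>)\<^sup>2"]
      have "t powr (-1/2) * (\<nu> - \<mu>)\<^sup>2 * norm (R (t + \<nu>) (R (t + \<mu>) ?y))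
          \<le> (norm x / \<delta> / \<delta> * \<bar>\<nu> - \<mu>\<bar>\<^sup>2) * (t powr (-1/2) / (t + \<delta>))"
        by (simp add: mult_ac)
      moreover have "k t = t powr (-1/2) *\<^sub>R (R (t + \<nu>) x - R (t + \<mu>) x + (\<nu> - \<mu>) *\<^sub>R R (t + \<mu>) ?y)"
        unfolding k_def by (simp add: scaleR_add_right scaleR_diff_right mult.commute)
      ultimately show "norm (k t) \<le> (norm x / \<delta> / \<delta> * \<bar>\<nu> - \<mu>\<bar>\<^sup>2) * (t powr (-1/2) / (t + \<delta>))"
        unfolding e norm_scaleR by (simp add: mult.assoc)
    qed
    then show ?thesis by (simp add: C_def mult_ac)
  qed
  show ?thesis
    unfolding has_vector_derivative_def has_derivative_iff_norm
  proof (intro conjI bounded_linear_scaleR_left)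
    have "((\<lambda>s. C * \<bar>s - \<mu>\<bar>) \<longlongrightarrow> C * \<bar>\<mu> - \<mu>\<bar>) (at \<mu> within {0..})"
      by (intro tendsto_intros)
    then have lim: "((\<lambda>s. C * \<bar>s - \<mu>\<bar>) \<longlongrightarrow> 0) (at \<mu> within {0..})" by simp
    show "((\<lambda>s. norm (F s x - F \<mu> x - (s - \<mu>) *\<^sub>R (- (1/2) *\<^sub>R F \<mu> (R \<mu> x))) / norm (s - \<mu>)) \<longlongrightarrow> 0)
        (at \<mu> within {0..})"
    proof (rule tendsto_sandwich[OF _ _ tendsto_const lim])
      show "\<forall>\<^sub>F s in at \<mu> within {0..}.
          norm (F s x - F \<mu> x - (s - \<mu>) *\<^sub>R (- (1/2) *\<^sub>R F \<mu> (R \<mu> x))) / norm (s - \<mu>) \<le> C * \<bar>s - \<mu>\<bar>"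
        unfolding eventually_at_filter
        by (rule always_eventually) (use err in \<open>auto simp: divide_le_eq power2_eq_square mult.assoc\<close>)
    qed simp
  qed
qed

text \<open>For u = \<open>R 0 z\<close> one has R(s) u = u/s - R(s) z / s. The first term
  integrates to the main part, and in the second \<open>R s z\<close> is at most |z|/\<mu> because s
  \<ge> \<mu>.\<close>

lemma F_asymptotic:
  assumes \<mu>: "\<mu> > 0"
  shows "norm (F \<mu> (R 0 z) - (pi / sqrt \<mu>) *\<^sub>R R 0 z) \<le> pi / sqrt \<mu> / \<mu> * norm z"
proof -
  define u where "u = R 0 z"
  define k where "k t = t powr (-1/2) *\<^sub>R R (t + \<mu>) u - (t powr (-1/2) / (t + \<mu>)) *\<^sub>R u" for t
  have k: "(k has_integral F \<mu> u - (pi / sqrt \<mu>) *\<^sub>R u) {0<..}"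
    unfolding k_def resolvent_sqrt_integral_def using \<mu>
    by (intro has_integral_diff has_integral_scaleR_left integral_inverse_sqrt_over_shift
        integrable_integral sqrt_integrand_integrable) auto
  have g: "((\<lambda>t. (norm z / \<mu>) * (t powr (-1/2) / (t + \<mu>))) has_integral (norm z / \<mu>) * (pi / sqrt \<mu>)) {0<..}"
    by (intro has_integral_mult_right integral_inverse_sqrt_over_shift \<mu>)
  have "norm (F \<mu> u - (pi / sqrt \<mu>) *\<^sub>R u) \<le> (norm z / \<mu>) * (pi / sqrt \<mu>)"
    unfolding integral_unique[OF k, symmetric] integral_unique[OF g, symmetric]
  proof (rule integral_norm_bound_integral[OF has_integral_integrable[OF k] has_integral_integrable[OF g]])
    fix t :: real assume "t \<in> {0<..}"
    then have t: "t > 0" by simp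
    define s where "s = t + \<mu>"
    have s: "s > 0" "s \<ge> \<mu>" using t \<mu> by (auto simp: s_def)
    have "R s u = (1 / s) *\<^sub>R (s *\<^sub>R R s u)" using s by simp
    also have "\<dots> = (1 / s) *\<^sub>R (u - R s z)" using resolvent_identity_0[of s z] s by (simp add: u_def)
    finally have "R s u - (1 / s) *\<^sub>R u = - ((1 / s) *\<^sub>R R s z)" by (simp add: scaleR_diff_right)
    moreover have "norm (R s z) \<le> norm z / s"
      using norm_scaled_resolvent_le[of s z] s by (simp add: field_simps)
    then have "norm (R s z) \<le> norm z / \<mu>"
      using divide_left_mono[of \<mu> s "norm z"] s \<mu> by simp
    then have "1 / s * norm (R s z) \<le> 1 / s * (norm z / \<mu>)"
      using s by (intro mult_left_mono) auto
    ultimately have "norm (R s u - (1 / s) *\<^sub>R u) \<le> 1 / s * (norm z / \<mu>)" using s by simp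
    from mult_left_mono[OF this, of "t powr (-1/2)"]
    have "t powr (-1/2) * norm (R s u - (1 / s) *\<^sub>R u) \<le> (norm z / \<mu>) * (t powr (-1/2) / s)"
      by (simp add: mult_ac)
    moreover have "k t = t powr (-1/2) *\<^sub>R (R s u - (1 / s) *\<^sub>R u)"
      by (simp add: k_def s_def scaleR_diff_right)
    ultimately show "norm (k t) \<le> (norm z / \<mu>) * (t powr (-1/2) / (t + \<mu>))"
      by (simp add: s_def)
  qed
  then show ?thesis by (simp add: u_def mult_ac)
qed

lemma norm_F_le: "\<mu> > 0 \<Longrightarrow> norm (F \<mu> x) \<le> pi / sqrt \<mu> * norm x"
proof -
  assume \<mu>: "\<mu> > 0"
  obtain \<delta> where \<delta>: "\<delta> > 0" "\<And>\<mu> x. \<mu> \<ge> 0 \<Longrightarrow> norm (F \<mu> x) \<le> pi / sqrt (\<mu> + \<delta>) * norm x"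
    by (rule sqrt_integral_facts) blast
  have "norm (F \<mu> x) \<le> pi / sqrt (\<mu> + \<delta>) * norm x" using \<delta>(2) \<mu> by simp
  also have "\<dots> \<le> pi / sqrt \<mu> * norm x"
    using \<mu> \<delta>(1) by (intro mult_right_mono divide_left_mono) auto
  finally show ?thesis .
qed

text \<open>With \<open>F(\<mu>) = \<pi> (A + \<mu>)\<^sup>-\<^sup>1\<^sup>/\<^sup>2\<close> the function \<open>(F(\<mu>) (A + \<mu>) R(0) z, F(\<mu>)\<^sup>* y)\<close> is constant by
  \<open>F' = - F R / 2\<close>; its limit at infinity is read off \<open>F(\<mu>) \<sim> \<pi> \<mu>\<^sup>-\<^sup>1\<^sup>/\<^sup>2\<close>.\<close>

lemma F_0_F_0: "F 0 (F 0 z) = pi\<^sup>2 *\<^sub>R R 0 z"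
proof -
  interpret adj: coercive_form j "\<lambda>u v. b v u" by (rule flip)
  have "F 0 (F 0 z) \<bullet> y = (pi\<^sup>2 *\<^sub>R R 0 z) \<bullet> y" for y
  proof -
    define u where "u = R 0 z"
    \<comment> \<open>This is F(\<mu>) (A + \<mu>) u, with A u = z inserted.\<close>
    define X where "X \<mu> = F \<mu> z + \<mu> *\<^sub>R F \<mu> u" for \<mu>
    define Y where "Y \<mu> = F' \<mu> y" for \<mu>
    have D: "((\<lambda>\<mu>. X \<mu> \<bullet> Y \<mu>) has_derivative (\<lambda>h. 0)) (at \<mu> within {0..})" if "\<mu> \<in> {0..}" for \<mu>
    proof -
      have \<mu>: "\<mu> \<ge> 0" using that by simp
      have u_eq: "R \<mu> z + \<mu> *\<^sub>R R \<mu> u = u"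
        using resolvent_identity_0[OF \<mu>, of z] by (simp add: u_def)
      have "(X has_vector_derivative - (1/2) *\<^sub>R F \<mu> (R \<mu> z) + (\<mu> *\<^sub>R (- (1/2) *\<^sub>R F \<mu> (R \<mu> u)) + 1 *\<^sub>R F \<mu> u))
          (at \<mu> within {0..})"
        unfolding X_def
        by (intro has_vector_derivative_add has_vector_derivative_scaleR F_has_vector_derivative \<mu>) auto
      moreover have "- (1/2) *\<^sub>R F \<mu> (R \<mu> z) + (\<mu> *\<^sub>R (- (1/2) *\<^sub>R F \<mu> (R \<mu> u)) + 1 *\<^sub>R F \<mu> u)
          = F \<mu> u - (1/2) *\<^sub>R F \<mu> (R \<mu> z + \<mu> *\<^sub>R R \<mu> u)"
        by (simp add: F_add F_scaleR \<mu> scaleR_add_right)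
      ultimately have "(X has_vector_derivative F \<mu> u - (1/2) *\<^sub>R F \<mu> u) (at \<mu> within {0..})"
        by (simp only: u_eq)
      then have dX: "(X has_derivative (\<lambda>h. h *\<^sub>R (F \<mu> u - (1/2) *\<^sub>R F \<mu> u))) (at \<mu> within {0..})"
        by (simp add: has_vector_derivative_def)
      have dY: "(Y has_derivative (\<lambda>h. h *\<^sub>R (- (1/2) *\<^sub>R F' \<mu> (R' \<mu> y)))) (at \<mu> within {0..})"
        unfolding Y_def has_vector_derivative_def[symmetric] by (rule adj.F_has_vector_derivative[OF \<mu>])
      \<comment> \<open>The resolvent undoes the factor A + \<mu> in \<open>X\<close>. Hence
        differentiating \<open>Y\<close> gives -1/2 and differentiating \<open>X\<close> gives +1/2
        of the same inner product.\<close>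
      have "R \<mu> (X \<mu>) = F \<mu> (R \<mu> z + \<mu> *\<^sub>R R \<mu> u)"
        by (simp add: X_def Rv_add Rv_scaleR j.add j.scaleR R_F_commute F_add F_scaleR \<mu>)
      then have RX: "R \<mu> (X \<mu>) = F \<mu> u" unfolding u_eq .
      have "X \<mu> \<bullet> F' \<mu> (R' \<mu> y) = R \<mu> (X \<mu>) \<bullet> F' \<mu> y"
        using adj.R_F_commute[OF \<mu> \<mu>, of y] resolvent_adjoint[OF \<mu>, of "X \<mu>" "F' \<mu> y"] by simp
      then have XY: "X \<mu> \<bullet> F' \<mu> (R' \<mu> y) = F \<mu> u \<bullet> Y \<mu>" unfolding RX Y_def .
      have "((\<lambda>\<mu>. X \<mu> \<bullet> Y \<mu>) has_derivative
          (\<lambda>h. X \<mu> \<bullet> (h *\<^sub>R (- (1/2) *\<^sub>R F' \<mu> (R' \<mu> y))) + (h *\<^sub>R (F \<mu> u - (1/2) *\<^sub>R F \<mu> u)) \<bullet> Y \<mu>)) (at \<mu> within {0..})"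
        by (rule has_derivative_inner[OF dX dY])
      moreover have "(\<lambda>h. X \<mu> \<bullet> (h *\<^sub>R (- (1/2) *\<^sub>R F' \<mu> (R' \<mu> y))) + (h *\<^sub>R (F \<mu> u - (1/2) *\<^sub>R F \<mu> u)) \<bullet> Y \<mu>) = (\<lambda>h. 0)"
        by (simp add: XY inner_diff_left fun_eq_iff algebra_simps)
      ultimately show ?thesis by simp
    qed
    obtain c where c: "\<And>\<mu>. \<mu> \<in> {0..} \<Longrightarrow> X \<mu> \<bullet> Y \<mu> = c"
      using has_derivative_zero_constant[OF convex_real_interval(1) D] by blast
    have "\<bar>c - pi\<^sup>2 * (u \<bullet> y)\<bar> \<le> 3 * pi\<^sup>2 * norm z * norm y * (1 / \<mu>)" if \<mu>: "\<mu> > 0" for \<mu>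
    proof -
      define q where "q = pi / sqrt \<mu>"
      have q: "q * q = pi\<^sup>2 / \<mu>" "q \<ge> 0" using \<mu> by (auto simp: q_def power2_eq_square)
      define E where "E = F \<mu> u - q *\<^sub>R u"
      have E: "norm E \<le> q / \<mu> * norm z"
        using F_asymptotic[OF \<mu>, of z] by (simp add: E_def q_def u_def)
      have Yn: "norm (Y \<mu>) \<le> q * norm y"
        unfolding Y_def q_def by (rule adj.norm_F_le[OF \<mu>])
      \<comment> \<open>The asymptotics hold on D(A) only, while y is arbitrary. So after
        \<open>F \<mu> u\<close> has been replaced by \<open>q u\<close> in \<open>X\<close>, the
        remaining factor is moved from y back to u and replaced there too. Each of the three errors
        is O(1/\<mu>).\<close>
      have uY: "u \<bullet> Y \<mu> = F \<mu> u \<bullet> y" unfolding Y_def using \<mu> by (simp add: F_adjoint)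
      have "c = F \<mu> z \<bullet> Y \<mu> + \<mu> * (E \<bullet> Y \<mu>) + \<mu> * q * (F \<mu> u \<bullet> y)"
        using c[of \<mu>] \<mu> by (simp add: X_def E_def inner_add_left inner_diff_left uY[symmetric] algebra_simps)
      also have "\<dots> = F \<mu> z \<bullet> Y \<mu> + \<mu> * (E \<bullet> Y \<mu>) + \<mu> * q * (E \<bullet> y) + \<mu> * (q * q) * (u \<bullet> y)"
        by (simp add: E_def inner_diff_left algebra_simps)
      also have "\<mu> * (q * q) = pi\<^sup>2" using \<mu> by (simp add: q)
      finally have dec: "c - pi\<^sup>2 * (u \<bullet> y) = F \<mu> z \<bullet> Y \<mu> + \<mu> * (E \<bullet> Y \<mu>) + \<mu> * q * (E \<bullet> y)" by simp
      have t1: "\<bar>F \<mu> z \<bullet> Y \<mu>\<bar> \<le> pi\<^sup>2 / \<mu> * norm z * norm y"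
      proof -
        have "\<bar>F \<mu> z \<bullet> Y \<mu>\<bar> \<le> norm (F \<mu> z) * norm (Y \<mu>)" by (rule Cauchy_Schwarz_ineq2)
        also have "\<dots> \<le> (q * norm z) * (q * norm y)"
          using norm_F_le[OF \<mu>, of z, folded q_def] q(2) Yn by (intro mult_mono) auto
        also have "\<dots> = (q * q) * norm z * norm y" by simp
        finally show ?thesis by (simp only: q)
      qed
      have t2: "\<bar>\<mu> * (E \<bullet> Y \<mu>)\<bar> \<le> pi\<^sup>2 / \<mu> * norm z * norm y"
      proof -
        have "\<bar>E \<bullet> Y \<mu>\<bar> \<le> norm E * norm (Y \<mu>)" by (rule Cauchy_Schwarz_ineq2)
        also have "\<dots> \<le> (q / \<mu> * norm z) * (q * norm y)"
          using E Yn q \<mu> by (intro mult_mono) auto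
        finally have "\<mu> * \<bar>E \<bullet> Y \<mu>\<bar> \<le> \<mu> * ((q / \<mu> * norm z) * (q * norm y))"
          using \<mu> by (intro mult_left_mono) auto
        also have "\<dots> = (q * q) * norm z * norm y" using \<mu> by simp
        finally show ?thesis using \<mu> by (simp add: q(1) abs_mult)
      qed
      have t3: "\<bar>\<mu> * q * (E \<bullet> y)\<bar> \<le> pi\<^sup>2 / \<mu> * norm z * norm y"
      proof -
        have "\<bar>E \<bullet> y\<bar> \<le> norm E * norm y" by (rule Cauchy_Schwarz_ineq2)
        also have "\<dots> \<le> (q / \<mu> * norm z) * norm y"
          using E by (intro mult_right_mono) auto
        finally have "\<mu> * q * \<bar>E \<bullet> y\<bar> \<le> \<mu> * q * ((q / \<mu> * norm z) * norm y)"
          using \<mu> q by (intro mult_left_mono) auto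
        also have "\<dots> = (q * q) * norm z * norm y" using \<mu> by simp
        finally show ?thesis using \<mu> q(2) by (simp add: q(1) abs_mult)
      qed
      have "3 * pi\<^sup>2 * norm z * norm y * (1 / \<mu>) = 3 * (pi\<^sup>2 / \<mu> * norm z * norm y)" by simp
      then show ?thesis using dec t1 t2 t3 by linarith
    qed
    then have "\<bar>c - pi\<^sup>2 * (u \<bullet> y)\<bar> \<le> 3 * pi\<^sup>2 * norm z * norm y * (1 / real (Suc n))" for n by simp
    moreover have "(\<lambda>n. 3 * pi\<^sup>2 * norm z * norm y * (1 / real (Suc n))) \<longlonglongrightarrow> 3 * pi\<^sup>2 * norm z * norm y * 0"
      by (intro tendsto_mult tendsto_const LIMSEQ_Suc[OF lim_1_over_n])
    ultimately have "\<bar>c - pi\<^sup>2 * (u \<bullet> y)\<bar> \<le> 3 * pi\<^sup>2 * norm z * norm y * 0"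
      by (intro LIMSEQ_le_const) auto
    then have "c = pi\<^sup>2 * (u \<bullet> y)" by simp
    moreover have "c = F 0 (F 0 z) \<bullet> y"
      using c[of 0] by (simp add: X_def Y_def F_adjoint)
    ultimately show ?thesis by (simp add: u_def)
  qed
  then show ?thesis by (metis inner_commute vector_eq_ldot)
qed

end

lemma continuous_le_of_dense:
  fixes f g :: "'a::metric_space \<Rightarrow> real"
  assumes "closure S = UNIV" "continuous_on UNIV f" "continuous_on UNIV g" "\<And>x. x \<in> S \<Longrightarrow> f x \<le> g x"
  shows "f x \<le> g x"
proof -
  have "f x - g x \<le> 0"
    by (rule continuous_le_on_closure[where S = S]) (use assms in \<open>auto intro!: continuous_intros\<close>)
  then show ?thesis by simp
qed

section \<open>From the bound on \<open>F 0\<close> to its range and the equivalence of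
  norms\<close>

context coercive_form
begin

text \<open>For x in D(A), \<open>F 0 x\<close> already lies in V. The hypothesis then bounds b(p,
  \<phi>) for \<phi> in the domain of the adjoint, by density for all \<phi>, and \<phi> = p with
  coercivity gives the norm bound. General x follow by completeness of V.\<close>

lemma F_0_in_form_domain:
  assumes K: "\<And>x y. \<bar>F 0 x \<bullet> y\<bar> \<le> K * norm x * norm (Rv' 0 y)" "K \<ge> 0"
  shows "\<exists>C. \<forall>x. \<exists>p. j p = F 0 x \<and> norm p \<le> C * norm x"
proof -
  interpret adj: coercive_form j "\<lambda>u v. b v u" by (rule flip)
  obtain c where c: "c > 0" "\<And>u. c * (norm u)\<^sup>2 \<le> b u u" using coercive by blast
  have on_range: "norm (Rv 0 (F 0 z)) \<le> K / c * norm (R 0 z)" for z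
  proof -
    define p where "p = Rv 0 (F 0 z)"
    have jp: "j p = F 0 (R 0 z)" by (simp add: p_def R_F_commute)
    have "b p p \<le> K * norm (R 0 z) * norm p"
    proof (rule continuous_le_of_dense[OF adj.closure_range_Rv, of "b p" "\<lambda>\<phi>. K * norm (R 0 z) * norm \<phi>"])
      fix \<phi> assume "\<phi> \<in> range (Rv' 0)"
      then obtain y where \<phi>: "\<phi> = Rv' 0 y" by blast
      have "b p \<phi> = F 0 (R 0 z) \<bullet> y"
        using adj.resolvent_0_eq[where x = y and \<phi> = p] by (simp add: \<phi> jp inner_commute)
      then show "b p \<phi> \<le> K * norm (R 0 z) * norm \<phi>"
        using K(1)[of "R 0 z" y] \<phi> by simp
    qed (intro linear_continuous_on[OF b.bounded_linear_right] continuous_intros)+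
    then have "(c * norm p) * norm p \<le> (K * norm (R 0 z)) * norm p"
      using c(2)[of p] by (simp add: power2_eq_square)
    then have "c * norm p \<le> K * norm (R 0 z)"
      using K(2) by (cases "norm p = 0") (auto simp: mult_le_cancel_right)
    then show ?thesis using c(1) by (simp add: p_def field_simps)
  qed
  have "\<exists>p. j p = F 0 x \<and> norm p \<le> K / c * norm x" for x
  proof -
    have "x \<in> closure (range (R 0))" by (simp add: closure_range_R)
    then obtain g where g: "\<forall>n. g n \<in> range (R 0)" "g \<longlonglongrightarrow> x"
      unfolding closure_sequential by blast
    from g(1) have "\<forall>n. \<exists>z. g n = R 0 z" by blast
    then obtain z where "\<forall>n. g n = R 0 (z n)" by metis
    then have z: "(\<lambda>n. R 0 (z n)) \<longlonglongrightarrow> x" using g(2) by (simp flip: fun_eq_iff)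
    have FL: "bounded_linear (F 0)" by (rule bounded_linear_F) simp
    have "Cauchy (\<lambda>n. Rv 0 (F 0 (z n)))"
    proof (rule metric_CauchyI)
      fix e :: real assume e: "e > 0"
      \<comment> \<open>The 1 is added since K may be 0.\<close>
      have "e / (K / c + 1) > 0" using e K(2) c(1) by (simp add: add_nonneg_pos)
      then obtain N where N: "\<And>m n. m \<ge> N \<Longrightarrow> n \<ge> N \<Longrightarrow> dist (R 0 (z m)) (R 0 (z n)) < e / (K / c + 1)"
        using metric_CauchyD[OF LIMSEQ_imp_Cauchy[OF z]] by blast
      show "\<exists>M. \<forall>m\<ge>M. \<forall>n\<ge>M. dist (Rv 0 (F 0 (z m))) (Rv 0 (F 0 (z n))) < e"
      proof (intro exI[of _ N] allI impI)
        fix m n assume mn: "m \<ge> N" "n \<ge> N"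
        have "dist (Rv 0 (F 0 (z m))) (Rv 0 (F 0 (z n))) = norm (Rv 0 (F 0 (z m - z n)))"
          by (simp add: dist_norm F_diff Rv_diff)
        also have "\<dots> \<le> K / c * norm (R 0 (z m - z n))" by (rule on_range)
        also have "\<dots> = K / c * dist (R 0 (z m)) (R 0 (z n))" by (simp add: dist_norm Rv_diff j.diff)
        also have "\<dots> \<le> (K / c + 1) * dist (R 0 (z m)) (R 0 (z n))"
          by (intro mult_right_mono) auto
        also have "\<dots> < e"
          using N[OF mn] K(2) c(1) by (simp add: pos_less_divide_eq add_nonneg_pos mult.commute)
        finally show "dist (Rv 0 (F 0 (z m))) (Rv 0 (F 0 (z n))) < e" .
      qed
    qed
    then obtain p where p: "(\<lambda>n. Rv 0 (F 0 (z n))) \<longlonglongrightarrow> p"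
      using Cauchy_convergent convergent_def by blast
    have "(\<lambda>n. j (Rv 0 (F 0 (z n)))) \<longlonglongrightarrow> j p" by (rule j.tendsto[OF p])
    moreover have "(\<lambda>n. F 0 (R 0 (z n))) \<longlonglongrightarrow> F 0 x" by (rule bounded_linear.tendsto[OF FL z])
    then have "(\<lambda>n. j (Rv 0 (F 0 (z n)))) \<longlonglongrightarrow> F 0 x" by (simp add: R_F_commute)
    ultimately have "j p = F 0 x" by (rule LIMSEQ_unique)
    moreover have "norm p \<le> K / c * norm x"
      by (rule LIMSEQ_le[OF tendsto_norm[OF p] tendsto_mult[OF tendsto_const tendsto_norm[OF z]]])
        (use on_range in blast)
    ultimately show ?thesis by blast
  qed
  then show ?thesis by blast
qed

text \<open>Let f be \<open>F 0\<close> as a map into V. If x = \<open>F 0 z\<close>, then |x|^2 is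
  the inner product of z with \<open>F' 0 x\<close>, hence b(\<open>Rv 0 z\<close>, q) with q
  bounded by x, and \<open>Rv 0 z\<close> is a multiple of f x because \<open>F 0\<close> squares to
  a multiple of \<open>R 0\<close>. This bounds f below on a dense set, hence everywhere.\<close>

lemma F_0_bijective:
  assumes dom: "\<And>x. \<exists>p. j p = F 0 x \<and> norm p \<le> C * norm x"
    and dom': "\<And>x. \<exists>p. j p = F' 0 x \<and> norm p \<le> C' * norm x"
  obtains K where "K > 0" "\<And>p x. j p = F 0 x \<Longrightarrow> norm p \<le> K * norm x \<and> norm x \<le> K * norm p"
    "range (F 0) = range j"
proof -
  interpret adj: coercive_form j "\<lambda>u v. b v u" by (rule flip)
  obtain f where f: "\<And>x. j (f x) = F 0 x" "\<And>x. norm (f x) \<le> C * norm x" using dom by metis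
  have f_eq: "f x = p" if "j p = F 0 x" for x p
    using that f(1)[of x] j_inj by (metis injD)
  have f_lin: "bounded_linear f"
    by (rule bounded_linear_intro[of _ C])
      (auto intro!: f_eq simp: j.add j.scaleR f F_add F_scaleR mult.commute)
  obtain B where B: "B > 0" "\<And>u v. norm (b u v) \<le> norm u * norm v * B" using b.pos_bounded by blast
  define K where "K = max 1 (max \<bar>C\<bar> (\<bar>C'\<bar> * B / pi\<^sup>2))"
  have f_F: "f (F 0 z) = pi\<^sup>2 *\<^sub>R Rv 0 z" for z
    by (rule f_eq) (simp add: F_0_F_0 j.scaleR)
  have R_in: "Rv 0 z = f (F 0 ((1 / pi\<^sup>2) *\<^sub>R z))" for z
    by (simp add: f_F Rv_scaleR)
  have lower_range: "norm x \<le> \<bar>C'\<bar> * B / pi\<^sup>2 * norm (f x)" if "x \<in> range (F 0)" for x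
  proof -
    from that obtain z where x: "x = F 0 z" by blast
    obtain q where q: "j q = F' 0 x" "norm q \<le> C' * norm x" using dom' by blast
    have "x \<bullet> x = z \<bullet> j q" using F_adjoint[of 0 z x] by (simp add: x q(1)[unfolded x])
    also have "\<dots> = b (Rv 0 z) q" by (rule resolvent_0_eq[symmetric])
    also have "\<dots> = b (f x) q / pi\<^sup>2" by (simp add: x f_F b.scaleR_left)
    finally have "norm x * norm x = b (f x) q / pi\<^sup>2"
      by (simp add: power2_norm_eq_inner[symmetric] power2_eq_square)
    also have "\<dots> \<le> norm (f x) * norm q * B / pi\<^sup>2"
      using B(2)[of "f x" q] by (intro divide_right_mono) auto
    also have "\<dots> \<le> norm (f x) * (\<bar>C'\<bar> * norm x) * B / pi\<^sup>2"
      using order_trans[OF q(2) mult_right_mono[OF abs_ge_self norm_ge_zero]] B(1)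
      by (intro divide_right_mono mult_right_mono mult_left_mono) auto
    finally have le: "norm x * norm x \<le> (\<bar>C'\<bar> * B / pi\<^sup>2 * norm (f x)) * norm x"
      by (simp add: mult_ac)
    show ?thesis
    proof (cases "x = 0")
      case False
      with mult_right_le_imp_le[OF le] show ?thesis by simp
    qed (use B(1) in simp)
  qed
  have "range (R 0) \<subseteq> range (F 0)"
  proof (rule image_subsetI)
    show "R 0 z \<in> range (F 0)" for z unfolding R_in[of z] f(1) by (rule rangeI)
  qed
  then have cl: "closure (range (F 0)) = UNIV"
    using closure_range_R closure_mono by blast
  have lower: "norm x \<le> \<bar>C'\<bar> * B / pi\<^sup>2 * norm (f x)" for x
    by (rule continuous_le_of_dense[OF cl _ _ lower_range])
      (auto intro!: continuous_intros linear_continuous_on[OF f_lin])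
  have K: "K > 0" "norm (f x) \<le> K * norm x" "norm x \<le> K * norm (f x)" for x
  proof -
    show "K > 0" by (simp add: K_def)
    have CK: "C \<le> K" "\<bar>C'\<bar> * B / pi\<^sup>2 \<le> K" by (auto simp: K_def)
    show "norm (f x) \<le> K * norm x" "norm x \<le> K * norm (f x)"
      by (rule order_trans[OF f(2) mult_right_mono[OF CK(1) norm_ge_zero]]
          order_trans[OF lower mult_right_mono[OF CK(2) norm_ge_zero]])+
  qed
  \<comment> \<open>Bounded below, f has closed range. That range contains D(A), which is dense in
    V, so f is onto.\<close>
  have "complete (range f)"
  proof (rule complete_isometric_image[of "1 / K"])
    show "\<forall>x\<in>UNIV. 1 / K * norm x \<le> norm (f x)"
      using K by (auto simp: field_simps)
  qed (use K f_lin in \<open>auto simp: complete_UNIV\<close>)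
  then have "closed (range f)" by (rule complete_imp_closed)
  moreover have "range (Rv 0) \<subseteq> range f" using R_in by auto
  ultimately have "range f = UNIV"
    using closure_range_Rv closure_minimal[of "range (Rv 0)" "range f"] by auto
  moreover have "range (F 0) = j ` range f" by (simp add: image_image f(1))
  ultimately have "range (F 0) = range j" by simp
  moreover have "norm p \<le> K * norm x \<and> norm x \<le> K * norm p" if "j p = F 0 x" for p x
    using K f_eq[OF that] by auto
  ultimately show thesis using that K(1) by blast
qed

section \<open>Quasi-symmetry: domain inclusions and quadratic estimates for A and its
  adjoint\<close>

lemma eq_of_inner_range:
  assumes "\<And>\<phi>. x \<bullet> j \<phi> = y \<bullet> j \<phi>" shows "x = y"
proof -
  have "(x - y) \<bullet> (x - y) \<le> 0"
    by (rule continuous_le_of_dense[OF j_dense, of "\<lambda>h. (x - y) \<bullet> h" "\<lambda>h. 0"])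
      (use assms in \<open>auto intro!: continuous_intros simp: inner_diff_left\<close>)
  then show ?thesis by (metis antisym eq_iff_diff_eq_0 inner_eq_zero_iff inner_ge_zero)
qed

text \<open>The condition says \<open>Re (L u, u) \<ge> (1 + \<alpha>) |u|\<^sup>2\<close> for \<open>L = S A\<^sup>-\<^sup>1\<close>, where \<open>S\<close> is the operator of
  the symmetric form \<open>s\<close>; \<open>\<beta>\<close> makes \<open>L\<close> bounded. So \<open>L\<close> is invertible and \<open>D(S) \<subseteq> D(A)\<close>.\<close>

lemma quasi_symmetric_imp_symmetric_domain:
  assumes \<alpha>: "\<alpha> > -1" and M: "M \<ge> 0" and "\<beta> \<ge> 0"
    and qs1: "\<And>x. \<alpha> * (norm (R 0 x))\<^sup>2 \<le> R' 0 (x + M *\<^sub>R R 0 x) \<bullet> R 0 x"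
    and qs2: "\<And>x. norm (R' 0 x) \<le> \<beta> * norm (R 0 x)"
    and s: "\<And>u v. s u v = b u v + b v u + M * (j u \<bullet> j v)"
  shows "\<exists>y. norm y \<le> norm f / (1 + \<alpha>) \<and> (\<forall>\<phi>. s (Rv 0 y) \<phi> = f \<bullet> j \<phi>)"
proof -
  interpret adj: coercive_form j "\<lambda>u v. b v u" by (rule flip)
  obtain k where k: "k > 0" "\<And>x. norm (R 0 x) \<le> norm x * k"
    using bounded_linear.pos_bounded[OF bounded_linear_R[of 0]] by auto
  define K where "K = 1 + \<beta> + M * k"
  have K: "K \<ge> 0" using assms k by (simp add: K_def)
  have bound: "\<bar>s (Rv 0 y) \<phi>\<bar> \<le> K * norm y * norm (j \<phi>)" for y \<phi>
  proof (rule continuous_le_of_dense[OF closure_range_Rv, of "\<lambda>\<phi>. \<bar>s (Rv 0 y) \<phi>\<bar>"])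
    show "continuous_on UNIV (\<lambda>\<phi>. \<bar>s (Rv 0 y) \<phi>\<bar>)"
      unfolding s by (intro continuous_intros linear_continuous_on b.bounded_linear_right b.bounded_linear_left j_lin)
    show "continuous_on UNIV (\<lambda>\<phi>. K * norm y * norm (j \<phi>))"
      by (intro continuous_intros linear_continuous_on j_lin)
    \<comment> \<open>For \<phi> in D(A), the term b(\<phi>, \<open>Rv 0 y\<close>) becomes the
      inner product of \<open>R' 0 x\<close> with y, which \<beta> controls by the norm of
      \<open>j \<phi>\<close>. The summands 1, \<beta> and M k of \<open>K\<close> belong to the
      three terms of \<open>s\<close>.\<close>
    fix \<phi> assume "\<phi> \<in> range (Rv 0)"
    then obtain x where \<phi>: "\<phi> = Rv 0 x" by blast
    have "s (Rv 0 y) \<phi> = y \<bullet> R 0 x + R' 0 x \<bullet> y + M * (R 0 y \<bullet> R 0 x)"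
      using adj.resolvent_adjoint[of 0 x y] by (simp add: s \<phi> resolvent_0_eq)
    also have "\<bar>\<dots>\<bar> \<le> \<bar>y \<bullet> R 0 x\<bar> + \<bar>R' 0 x \<bullet> y\<bar> + M * \<bar>R 0 y \<bullet> R 0 x\<bar>"
      using abs_mult[of M "R 0 y \<bullet> R 0 x"] M by linarith
    also have "\<dots> \<le> norm y * norm (R 0 x) + \<beta> * norm (R 0 x) * norm y + M * ((norm y * k) * norm (R 0 x))"
    proof (intro add_mono mult_left_mono M)
      show "\<bar>y \<bullet> R 0 x\<bar> \<le> norm y * norm (R 0 x)" by (rule Cauchy_Schwarz_ineq2)
      show "\<bar>R' 0 x \<bullet> y\<bar> \<le> \<beta> * norm (R 0 x) * norm y"
        by (rule order_trans[OF Cauchy_Schwarz_ineq2 mult_right_mono[OF qs2 norm_ge_zero]])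
      show "\<bar>R 0 y \<bullet> R 0 x\<bar> \<le> (norm y * k) * norm (R 0 x)"
        by (rule order_trans[OF Cauchy_Schwarz_ineq2 mult_right_mono[OF k(2) norm_ge_zero]])
    qed
    also have "\<dots> = K * norm y * norm (j \<phi>)" by (simp add: K_def \<phi> algebra_simps)
    finally show "\<bar>s (Rv 0 y) \<phi>\<bar> \<le> K * norm y * norm (j \<phi>)" .
  qed
  have "\<exists>h. \<forall>\<phi>. h \<bullet> j \<phi> = s (Rv 0 y) \<phi>" for y
  proof -
    have inv_j: "inv j (j \<phi>) = \<phi>" for \<phi> by (rule inv_f_f[OF j_inj])
    have W: "subspace (range j)"
      by (rule linear_subspace_image[OF bounded_linear.linear[OF j_lin] subspace_UNIV])
    have s_lin: "s w (\<phi> + \<psi>) = s w \<phi> + s w \<psi>" "s w (r *\<^sub>R \<phi>) = r * s w \<phi>" for w \<phi> \<psi> r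
      by (simp_all add: s b.add_left b.add_right b.scaleR_left b.scaleR_right j.add j.scaleR
          inner_add_right algebra_simps)
    \<comment> \<open>Riesz in H itself, on the dense subspace \<open>range j\<close>. The
      functional lives on V and is carried over by \<open>inv j\<close>.\<close>
    have "\<exists>h. \<forall>v\<in>range j. h \<bullet> v = s (Rv 0 y) (inv j v)"
    proof (rule riesz_representation_subspace[where c = 1 and K = "K * norm y" and
            l = "\<lambda>v. s (Rv 0 y) (inv j v)", OF bounded_bilinear_inner inner_commute _ _ W])
      fix u v assume "u \<in> range j" "v \<in> range j"
      then obtain \<phi> \<psi> where "u = j \<phi>" "v = j \<psi>" by blast
      then show "s (Rv 0 y) (inv j (u + v)) = s (Rv 0 y) (inv j u) + s (Rv 0 y) (inv j v)"
        by (simp only: j.add[symmetric] inv_j s_lin)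
    next
      fix r u assume "u \<in> range j"
      then obtain \<phi> where "u = j \<phi>" by blast
      then show "s (Rv 0 y) (inv j (r *\<^sub>R u)) = r * s (Rv 0 y) (inv j u)"
        by (simp only: j.scaleR[symmetric] inv_j s_lin)
    next
      fix u assume "u \<in> range j"
      then show "\<bar>s (Rv 0 y) (inv j u)\<bar> \<le> K * norm y * norm u"
        using bound inv_j by auto
    qed (auto simp: power2_norm_eq_inner)
    then show ?thesis by (metis inv_j rangeI)
  qed
  then obtain L where L: "\<And>y \<phi>. L y \<bullet> j \<phi> = s (Rv 0 y) \<phi>" by metis
  have L_bound: "\<bar>L y \<bullet> h\<bar> \<le> K * norm y * norm h" for y h
    by (rule continuous_le_of_dense[OF j_dense, of "\<lambda>h. \<bar>L y \<bullet> h\<bar>"])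
      (use bound in \<open>auto intro!: continuous_intros simp: L\<close>)
  have L_lin: "bounded_linear L"
  proof (rule bounded_linear_intro[of _ K])
    show "L (x + y) = L x + L y" for x y
      by (rule eq_of_inner_range)
        (simp add: inner_add_left L s Rv_add b.add_left b.add_right j.add algebra_simps)
    show "L (r *\<^sub>R x) = r *\<^sub>R L x" for r x
      by (rule eq_of_inner_range) (simp add: L s Rv_scaleR b.scaleR_left b.scaleR_right j.scaleR algebra_simps)
    show "norm (L y) \<le> norm y * K" for y
    proof -
      have "norm (L y) * norm (L y) \<le> (norm y * K) * norm (L y)"
        using L_bound[of y "L y"] by (simp add: power2_norm_eq_inner[symmetric] power2_eq_square mult_ac)
      then show ?thesis using K by (cases "norm (L y) = 0") (auto simp: mult_le_cancel_right)
    qed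
  qed
  have L_coercive: "(1 + \<alpha>) * (norm h)\<^sup>2 \<le> L h \<bullet> h" for h
  proof (rule continuous_le_of_dense[OF closure_range_R, of "\<lambda>h. (1 + \<alpha>) * (norm h)\<^sup>2"])
    show "continuous_on UNIV (\<lambda>h. L h \<bullet> h)"
      by (intro continuous_intros linear_continuous_on L_lin)
    fix h assume "h \<in> range (R 0)"
    then obtain x where h: "h = R 0 x" by blast
    \<comment> \<open>With h = \<open>R 0 x\<close>, the first term of \<open>s\<close> contributes
      |h|^2. This is the 1 in 1 + \<alpha>, and why \<alpha> > -1 suffices.\<close>
    have "L h \<bullet> h = h \<bullet> h + x \<bullet> R 0 h + M * (R 0 h \<bullet> h)"
      using L[of h "Rv 0 x"] by (simp add: s resolvent_0_eq h)
    also have "x \<bullet> R 0 h = R' 0 x \<bullet> h" using adj.resolvent_adjoint[of 0 x h] by simp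
    \<comment> \<open>In the real inner product an operator and its adjoint have the same quadratic
      form, so the M-term takes the shape it has in \<open>qs1\<close>.\<close>
    also have "R 0 h \<bullet> h = R' 0 h \<bullet> h"
      using adj.resolvent_adjoint[of 0 h h] by (simp add: inner_commute)
    finally have "L h \<bullet> h = h \<bullet> h + R' 0 (x + M *\<^sub>R R 0 x) \<bullet> R 0 x"
      by (simp add: h adj.Rv_add adj.Rv_scaleR j.add j.scaleR inner_add_left)
    then show "(1 + \<alpha>) * (norm h)\<^sup>2 \<le> L h \<bullet> h"
      using qs1[of x] by (simp add: h power2_norm_eq_inner[symmetric] distrib_right)
  qed (auto intro!: continuous_intros)
  have "bounded_bilinear (\<lambda>y h. L y \<bullet> h)"
    using bounded_bilinear.comp[OF bounded_bilinear_inner L_lin bounded_linear_ident] by simp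
  moreover have "1 + \<alpha> > 0" using \<alpha> by simp
  \<comment> \<open>L y = f says that \<open>Rv 0 y\<close> solves the equation of S with datum f,
    so the solution lies in D(A).\<close>
  ultimately obtain y where y: "\<And>h. L y \<bullet> h = f \<bullet> h"
    using Lax_Milgram[of "\<lambda>y h. L y \<bullet> h" "1 + \<alpha>" "\<lambda>h. f \<bullet> h"] L_coercive bounded_linear_inner_right by blast
  have "s (Rv 0 y) \<phi> = f \<bullet> j \<phi>" for \<phi> using y[of "j \<phi>"] by (simp add: L)
  moreover have "norm y \<le> norm f / (1 + \<alpha>)"
  proof -
    have "((1 + \<alpha>) * norm y) * norm y \<le> norm f * norm y"
      using L_coercive[of y] norm_cauchy_schwarz[of f y] y[of y] by (simp add: power2_eq_square mult_ac)
    then have "(1 + \<alpha>) * norm y \<le> norm f" by (cases "norm y = 0") (auto simp: mult_le_cancel_right)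
    then show ?thesis using \<alpha> by (simp add: field_simps)
  qed
  ultimately show ?thesis by blast
qed

text \<open>The vector estimated is A R(t) v. On f, A R(t) = 1 - t R(t) has norm at most 2; on the
  second summand A cancels \<open>R 0\<close> and leaves the contraction t R(t) applied to
  y.\<close>

lemma norm_diff_resolvent_le:
  assumes "t \<ge> 0" and v: "j v = f + t *\<^sub>R R 0 y"
  shows "norm (j v - t *\<^sub>R R t (j v)) \<le> 2 * norm f + norm y"
proof -
  have "R t (j v) = R t f + t *\<^sub>R R t (R 0 y)"
    using assms by (simp add: v Rv_add Rv_scaleR j.add j.scaleR)
  also have "\<dots> = R t f + (R 0 y - R t y)" using resolvent_identity_0[OF assms(1)] by simp
  finally have e: "R t (j v) = R t f + (R 0 y - R t y)" .
  have "j v - t *\<^sub>R R t (j v) = f - t *\<^sub>R R t f + t *\<^sub>R R t y"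
    unfolding e by (simp add: v algebra_simps)
  also have "norm \<dots> \<le> norm f + norm (t *\<^sub>R R t f) + norm (t *\<^sub>R R t y)"
    by (meson add_mono norm_triangle_ineq norm_triangle_ineq4 order_refl order_trans)
  also have "\<dots> \<le> norm f + norm f + norm y"
    by (intro add_mono norm_scaled_resolvent_le order_refl assms)
  finally show ?thesis by simp
qed

text \<open>If \<open>D(S) \<subseteq> D(A)\<close> for a symmetric form \<open>s\<close> with operator \<open>S\<close>, then \<open>A (t + A)\<^sup>-\<^sup>1 v\<close> is dominated
  by \<open>S (t + S)\<^sup>-\<^sup>1 v\<close>, whose square integral is at most \<open>s v v\<close>.\<close>

lemma integral_le_of_symmetric_domain:
  assumes s: "coercive_form j s" and sym: "\<And>u v. s u v = s v u"
    and dom: "\<And>f. \<exists>y. norm y \<le> K * norm f \<and> (\<forall>\<phi>. s (Rv 0 y) \<phi> = f \<bullet> j \<phi>)" and K: "K \<ge> 0"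
  shows "\<exists>L\<ge>0. \<forall>lo hi v. 0 \<le> lo \<longrightarrow> lo \<le> hi \<longrightarrow>
    integral {lo..hi} (\<lambda>t. (norm (j v - t *\<^sub>R R t (j v)))\<^sup>2) \<le> L * (norm v)\<^sup>2"
proof -
  interpret S: coercive_form j s by (rule s)
  obtain B where B: "B > 0" "\<And>u v. norm (s u v) \<le> norm u * norm v * B" using S.b.pos_bounded by blast
  have le: "norm (j v - t *\<^sub>R R t (j v)) \<le> (2 + K) * norm (j v - t *\<^sub>R S.R t (j v))" if t: "t \<ge> 0" for t v
  proof -
    define f where "f = j v - t *\<^sub>R S.R t (j v)"
    obtain y where y: "norm y \<le> K * norm f" "\<And>\<phi>. s (Rv 0 y) \<phi> = f \<bullet> j \<phi>" using dom by blast
    \<comment> \<open>Here f is S (t + S)^-1 v, so (t + S)^-1 v is the solution for S with datum f,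
      and v = f + t (t + S)^-1 v has the shape required above.\<close>
    have "S.Rv t (j v) = Rv 0 y"
    proof (rule S.resolvent_form_unique[of 0])
      fix \<phi>
      show "s (S.Rv t (j v)) \<phi> + 0 * (S.R t (j v) \<bullet> j \<phi>) = s (Rv 0 y) \<phi> + 0 * (R 0 y \<bullet> j \<phi>)"
        using S.resolvent_eq[OF t, of "j v" \<phi>] by (simp add: y(2) f_def inner_diff_left)
    qed simp
    then have "j v = f + t *\<^sub>R R 0 y" by (simp add: f_def)
    from norm_diff_resolvent_le[OF t this] y(1) show ?thesis
      unfolding f_def[symmetric] by (simp add: algebra_simps)
  qed
  have "integral {lo..hi} (\<lambda>t. (norm (j v - t *\<^sub>R R t (j v)))\<^sup>2) \<le> ((2 + K)\<^sup>2 * B) * (norm v)\<^sup>2"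
    if lo: "0 \<le> lo" "lo \<le> hi" for lo hi v
  proof -
    have sub: "{lo..hi} \<subseteq> {0..}" using lo by auto
    have "integral {lo..hi} (\<lambda>t. (norm (j v - t *\<^sub>R R t (j v)))\<^sup>2)
        \<le> integral {lo..hi} (\<lambda>t. (2 + K)\<^sup>2 * (norm (j v - t *\<^sub>R S.R t (j v)))\<^sup>2)"
    proof (rule integral_le)
      fix t assume "t \<in> {lo..hi}"
      then have t: "t \<ge> 0" using lo by simp
      have "(norm (j v - t *\<^sub>R R t (j v)))\<^sup>2 \<le> ((2 + K) * norm (j v - t *\<^sub>R S.R t (j v)))\<^sup>2"
        by (intro power_mono le t) auto
      then show "(norm (j v - t *\<^sub>R R t (j v)))\<^sup>2 \<le> (2 + K)\<^sup>2 * (norm (j v - t *\<^sub>R S.R t (j v)))\<^sup>2"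
        by (simp add: power_mult_distrib)
    qed (intro integrable_continuous_real continuous_intros continuous_on_subset[OF continuous_on_resolvent sub]
        continuous_on_subset[OF S.continuous_on_resolvent sub])+
    also have "\<dots> = (2 + K)\<^sup>2 * integral {lo..hi} (\<lambda>t. (norm (j v - t *\<^sub>R S.R t (j v)))\<^sup>2)"
      by simp
    also have "\<dots> \<le> (2 + K)\<^sup>2 * s v v"
      by (intro mult_left_mono S.symmetric_integral_le sym lo) auto
    also have "\<dots> \<le> (2 + K)\<^sup>2 * (norm v * norm v * B)"
      using B(2)[of v v] by (intro mult_left_mono) auto
    finally show ?thesis by (simp add: power2_eq_square mult_ac)
  qed
  then show ?thesis using B(1) K by (intro exI[of _ "(2 + K)\<^sup>2 * B"]) auto
qed

lemma quasi_symmetric_F_0: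
  assumes \<alpha>: "\<alpha> > -1" and M: "M \<ge> 0" and \<beta>: "\<beta> \<ge> 0"
    and qs1: "\<And>x. \<alpha> * (norm (R 0 x))\<^sup>2 \<le> R' 0 (x + M *\<^sub>R R 0 x) \<bullet> R 0 x"
    and qs2: "\<And>x. norm (R' 0 x) \<le> \<beta> * norm (R 0 x)"
  obtains K where "K > 0" "\<And>p x. j p = F 0 x \<Longrightarrow> norm p \<le> K * norm x \<and> norm x \<le> K * norm p"
    "range (F 0) = range j"
proof -
  interpret adj: coercive_form j "\<lambda>u v. b v u" by (rule flip)
  define s where "s u v = b u v + b v u + M * (j u \<bullet> j v)" for u v
  have sym: "s u v = s v u" for u v by (simp add: s_def inner_commute)
  have s: "coercive_form j s"
  proof (rule coercive_form.intro[OF j_lin j_inj j_dense])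
    have "bounded_bilinear (\<lambda>u v. j u \<bullet> (M *\<^sub>R j v))"
      by (rule bounded_bilinear.comp[OF bounded_bilinear_inner j_lin])
        (rule bounded_linear_const_scaleR[OF j_lin])
    then have "bounded_bilinear (\<lambda>u v. M * (j u \<bullet> j v))" by simp
    then show "bounded_bilinear s"
      unfolding s_def by (intro bounded_bilinear_add_fun b_bil bounded_bilinear.flip[OF b_bil])
    obtain c where c: "c > 0" "\<And>u. c * (norm u)\<^sup>2 \<le> b u u" using coercive by blast
    have "c * (norm u)\<^sup>2 \<le> s u u" for u
      using c(2)[of u] b_nonneg[of u] mult_nonneg_nonneg[OF M inner_ge_zero[of "j u"]]
      unfolding s_def by linarith
    then show "\<exists>c>0. \<forall>u. c * (norm u)\<^sup>2 \<le> s u u" using c(1) by blast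
  qed
  define K where "K = 1 / (1 + \<alpha>)"
  have K: "K \<ge> 0" using \<alpha> by (simp add: K_def)
  have dom: "\<exists>y. norm y \<le> K * norm f \<and> (\<forall>\<phi>. s (Rv 0 y) \<phi> = f \<bullet> j \<phi>)" for f
    using quasi_symmetric_imp_symmetric_domain[OF \<alpha> M \<beta> qs1 qs2 s_def, of f] by (simp add: K_def)
  obtain k where k: "k > 0" "\<And>x. norm (R 0 x) \<le> norm x * k"
    using bounded_linear.pos_bounded[OF bounded_linear_R[of 0]] by auto
  have dom': "\<exists>y. norm y \<le> (1 + K + M * k * K) * norm f \<and> (\<forall>\<phi>. s (Rv' 0 y) \<phi> = f \<bullet> j \<phi>)" for f
  proof -
    obtain y where y: "norm y \<le> K * norm f" "\<And>\<phi>. s (Rv 0 y) \<phi> = f \<bullet> j \<phi>" using dom by blast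
    \<comment> \<open>The adjoint applied to \<open>R 0 y\<close>, computed as S - A - M.\<close>
    define z where "z = f - y - M *\<^sub>R R 0 y"
    have "Rv' 0 z = Rv 0 y"
    proof (rule adj.resolvent_eqI)
      fix \<phi>
      show "b \<phi> (Rv 0 y) + 0 * (R 0 y \<bullet> j \<phi>) = z \<bullet> j \<phi>"
        using y(2)[of \<phi>] by (simp add: s_def z_def resolvent_0_eq inner_diff_left)
    qed simp
    moreover have "norm z \<le> (1 + K + M * k * K) * norm f"
    proof -
      have "norm z \<le> norm f + norm y + norm (M *\<^sub>R R 0 y)"
        unfolding z_def by (meson add_mono norm_triangle_ineq4 order_refl order_trans)
      also have "norm (M *\<^sub>R R 0 y) \<le> M * (norm y * k)"
        using k(2)[of y] M by (simp add: mult_left_mono)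
      also have "M * (norm y * k) \<le> M * ((K * norm f) * k)"
        using y(1) M k(1) by (intro mult_left_mono mult_right_mono) auto
      finally show ?thesis using y(1) by (simp add: algebra_simps)
    qed
    ultimately show ?thesis using y(2) by (intro exI[of _ z]) simp
  qed
  obtain L where L: "L \<ge> 0" "\<And>lo hi v. 0 \<le> lo \<Longrightarrow> lo \<le> hi \<Longrightarrow>
      integral {lo..hi} (\<lambda>t. (norm (j v - t *\<^sub>R R t (j v)))\<^sup>2) \<le> L * (norm v)\<^sup>2"
    using integral_le_of_symmetric_domain[OF s sym dom K] by blast
  have "1 + K + M * k * K \<ge> 0" using K M k(1) by simp
  then obtain L' where L': "L' \<ge> 0" "\<And>lo hi v. 0 \<le> lo \<Longrightarrow> lo \<le> hi \<Longrightarrow>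
      integral {lo..hi} (\<lambda>t. (norm (j v - t *\<^sub>R R' t (j v)))\<^sup>2) \<le> L' * (norm v)\<^sup>2"
    using adj.integral_le_of_symmetric_domain[OF s sym dom'] by blast
  \<comment> \<open>The roles cross: the estimate for the adjoint resolvent bounds
    \<open>F 0\<close>, that for the resolvent of A bounds \<open>F' 0\<close>.\<close>
  obtain C where C: "\<And>x. \<exists>p. j p = F 0 x \<and> norm p \<le> C * norm x"
    using F_0_in_form_domain[of "2 + 4 * L'", OF F_0_inner_le[OF L'(2,1)]] L'(1) by auto
  obtain C' where C': "\<And>x. \<exists>p. j p = F' 0 x \<and> norm p \<le> C' * norm x"
    using adj.F_0_in_form_domain[of "2 + 4 * L", OF adj.F_0_inner_le[OF L(2,1)]] L(1) by auto
  show thesis by (rule F_0_bijective[OF C C' that])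
qed


lemma R_0_inject: "R 0 x = R 0 y \<Longrightarrow> x = y"
proof (rule eq_of_inner_range)
  fix \<phi> assume "R 0 x = R 0 y"
  then have "Rv 0 x = Rv 0 y" using j_inj by (rule injD[rotated])
  then show "x \<bullet> j \<phi> = y \<bullet> j \<phi>" using resolvent_0_eq[of x \<phi>] resolvent_0_eq[of y \<phi>] by simp
qed

lemma resolvent_left_inverse: "t \<ge> 0 \<Longrightarrow> R t (t *\<^sub>R R 0 x + x) = R 0 x"
  using resolvent_identity_0[of t x] by (simp add: Rv_add Rv_scaleR j.add j.scaleR)

lemma resolvent_eq_R_0: "t \<ge> 0 \<Longrightarrow> R t x = R 0 (x - t *\<^sub>R R t x)"
  using resolvent_identity_0[of t x] resolvent_commute[of 0 t x] by (simp add: Rv_diff Rv_scaleR j.diff j.scaleR)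

end

subsection \<open>Complex forms\<close>

lemma cinner_scaleC_right: "cinner x (c *\<^sub>C y) = cnj c * cinner x y"
  by (metis cinner_commute cinner_scaleC_left complex_cnj_mult)

text \<open>Complex (anti)linearity recovers the imaginary parts from the real ones via \<open>\<i> \<phi>\<close>.\<close>

lemma complex_eq_of_Re_eq:
  fixes f g :: "'a::complex_normed_vector \<Rightarrow> complex"
  assumes "\<And>\<phi>. f (\<i> *\<^sub>C \<phi>) = c * f \<phi>" "\<And>\<phi>. g (\<i> *\<^sub>C \<phi>) = c * g \<phi>" "c = \<i> \<or> c = - \<i>"
    and Re: "\<And>\<phi>. Re (f \<phi>) = Re (g \<phi>)"
  shows "f \<phi> = g \<phi>"
  using Re[of \<phi>] Re[of "\<i> *\<^sub>C \<phi>"] assms(1-3) by (auto simp: complex_eq_iff)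

lemma coercive_form_Re:
  fixes j :: "'v::complex_banach \<Rightarrow> 'h::complex_hilbert" and a :: "'v \<Rightarrow> 'v \<Rightarrow> complex"
  assumes j: "dense_embedding j" and a: "sesquilinear a" "continuous_form a" "strongly_accretive a"
  shows "coercive_form j (\<lambda>u v. Re (a u v))"
proof (rule coercive_form.intro)
  show "bounded_linear j" "inj j" "closure (range j) = UNIV"
    using j unfolding dense_embedding_def by auto
  show "\<exists>c>0. \<forall>u. c * (norm u)\<^sup>2 \<le> Re (a u u)"
    using a(3) unfolding strongly_accretive_def by auto
  obtain C where C: "\<And>u v. cmod (a u v) \<le> C * norm u * norm v"
    using a(2) unfolding continuous_form_def by blast
  have scale: "a (r *\<^sub>R u) v = r * a u v" "a u (r *\<^sub>R v) = r * a u v" for r u v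
    using a(1) unfolding sesquilinear_def scaleC_of_real[symmetric] by auto
  show "bounded_bilinear (\<lambda>u v. Re (a u v))"
  proof
    show "\<exists>K. \<forall>u v. norm (Re (a u v)) \<le> norm u * norm v * K"
    proof (intro exI allI)
      show "norm (Re (a u v)) \<le> norm u * norm v * C" for u v
        using order_trans[OF abs_Re_le_cmod C[of u v]] by (simp add: mult_ac)
    qed
  qed (use a(1) in \<open>auto simp: sesquilinear_def scale\<close>)
qed

context
  fixes j :: "'v::complex_banach \<Rightarrow> 'h::complex_hilbert" and a :: "'v \<Rightarrow> 'v \<Rightarrow> complex"
  assumes j: "dense_embedding j" and a: "sesquilinear a" "continuous_form a" "strongly_accretive a"
begin

interpretation coercive_form j "\<lambda>u v. Re (a u v)"
  by (rule coercive_form_Re[OF j a])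

interpretation adj: coercive_form j "\<lambda>u v. Re (a v u)"
  by (rule flip)

lemma j_scaleC: "j (c *\<^sub>C v) = c *\<^sub>C j v"
  using j unfolding dense_embedding_def by blast

text \<open>This identifies the operator of the complex form with the inverse of the real
  \<open>R 0\<close>. Both sides are antilinear in \<phi>, so agreement of real parts is
  enough.\<close>

lemma form_eq_iff: "(\<forall>\<phi>. cinner f (j \<phi>) = a u \<phi>) \<longleftrightarrow> Rv 0 f = u"
proof
  assume "\<forall>\<phi>. cinner f (j \<phi>) = a u \<phi>"
  then show "Rv 0 f = u" by (intro resolvent_eqI) (simp_all add: inner_eq_Re_cinner)
next
  assume u: "Rv 0 f = u"
  have "cinner f (j \<phi>) = a u \<phi>" for \<phi>
  proof (rule complex_eq_of_Re_eq[where c = "- \<i>" and f = "\<lambda>\<phi>. cinner f (j \<phi>)" and g = "a u"])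
    show "Re (cinner f (j \<phi>)) = Re (a u \<phi>)" for \<phi>
      using resolvent_0_eq[of f \<phi>] by (simp add: u inner_eq_Re_cinner)
  qed (use a(1) in \<open>auto simp: j_scaleC cinner_scaleC_right sesquilinear_def\<close>)
  then show "\<forall>\<phi>. cinner f (j \<phi>) = a u \<phi>" by blast
qed

lemma form_dom_eq: "form_dom j a = range (R 0)"
  unfolding form_dom_def form_eq_iff by blast

lemma form_op_R: "form_op j a (R 0 x) = x"
  unfolding form_op_def form_eq_iff
  by (rule the_equality) (use R_0_inject in auto)

lemma R_0_scaleC: "R 0 (c *\<^sub>C x) = c *\<^sub>C R 0 x"
proof -
  have "\<forall>\<phi>. cinner x (j \<phi>) = a (Rv 0 x) \<phi>" by (simp only: form_eq_iff)
  then have "\<forall>\<phi>. cinner (c *\<^sub>C x) (j \<phi>) = a (c *\<^sub>C Rv 0 x) \<phi>"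
    using a(1) by (simp add: cinner_scaleC_left sesquilinear_def)
  then show ?thesis unfolding form_eq_iff by (simp add: j_scaleC)
qed

text \<open>Parametrising D(A) by \<open>R 0\<close> turns the defining relation of the adjoint into
  one for the bounded operator \<open>R 0\<close>, whose real adjoint is \<open>adj.R 0\<close>.
  Complex linearity of \<open>R 0\<close> removes the restriction to real parts.\<close>

lemma adjoint_eq_iff:
  "(\<forall>u\<in>form_dom j a. cinner (form_op j a u) w = cinner u g) \<longleftrightarrow> w = adj.R 0 g"
proof -
  have "(\<forall>u\<in>form_dom j a. cinner (form_op j a u) w = cinner u g)
      \<longleftrightarrow> (\<forall>x. cinner x w = cinner (R 0 x) g)"
    by (simp add: form_dom_eq form_op_R)
  also have "\<dots> \<longleftrightarrow> (\<forall>x. x \<bullet> w = x \<bullet> adj.R 0 g)"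
  proof
    assume "\<forall>x. cinner x w = cinner (R 0 x) g"
    then show "\<forall>x. x \<bullet> w = x \<bullet> adj.R 0 g"
      using resolvent_adjoint[of 0 _ g] by (simp add: inner_eq_Re_cinner)
  next
    assume w: "\<forall>x. x \<bullet> w = x \<bullet> adj.R 0 g"
    have "cinner x w = cinner (R 0 x) g" for x
    proof (rule complex_eq_of_Re_eq[where c = "\<i>" and f = "\<lambda>x. cinner x w" and g = "\<lambda>x. cinner (R 0 x) g"])
      show "Re (cinner x w) = Re (cinner (R 0 x) g)" for x
        using w by (simp add: resolvent_adjoint flip: inner_eq_Re_cinner)
    qed (auto simp: R_0_scaleC cinner_scaleC_left)
    then show "\<forall>x. cinner x w = cinner (R 0 x) g" by blast
  qed
  also have "\<dots> \<longleftrightarrow> w = adj.R 0 g" by (metis vector_eq_ldot)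
  finally show ?thesis .
qed

lemma adjoint_inv_eq: "adjoint_inv (form_dom j a) (form_op j a) f = adj.R 0 f"
proof -
  have op: "adjoint_op (form_dom j a) (form_op j a) (adj.R 0 g) = g" for g
    unfolding adjoint_op_def adjoint_eq_iff
    by (rule the_equality) (use adj.R_0_inject in auto)
  have "adjoint_dom (form_dom j a) (form_op j a) = range (adj.R 0)"
    unfolding adjoint_dom_def adjoint_eq_iff by blast
  then show ?thesis
    unfolding adjoint_inv_def by (intro the_inv_into_f_eq) (auto simp: inj_on_def op)
qed

lemma the_inv_into_shift_eq:
  assumes "t \<ge> 0"
  shows "the_inv_into (form_dom j a) (\<lambda>u. t *\<^sub>R u + form_op j a u) x = R t x"
proof (rule the_inv_into_f_eq)
  show "inj_on (\<lambda>u. t *\<^sub>R u + form_op j a u) (form_dom j a)"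
  proof (rule inj_on_inverseI[where g = "R t"])
    fix u assume "u \<in> form_dom j a"
    then obtain y where "u = R 0 y" unfolding form_dom_eq by blast
    then show "R t (t *\<^sub>R u + form_op j a u) = u"
      by (simp only: form_op_R resolvent_left_inverse[OF assms])
  qed
  show "R t x \<in> form_dom j a"
    unfolding form_dom_eq using resolvent_eq_R_0[OF assms, of x] by (rule range_eqI)
  have "form_op j a (R t x) = x - t *\<^sub>R R t x"
    by (subst resolvent_eq_R_0[OF assms]) (rule form_op_R)
  then show "t *\<^sub>R R t x + form_op j a (R t x) = x" by simp
qed

lemma inv_sqrt_op_eq: "inv_sqrt_op (form_dom j a) (form_op j a) x = (1 / pi) *\<^sub>R F 0 x"
  unfolding inv_sqrt_op_def resolvent_sqrt_integral_def
  by (intro arg_cong[where f = "(*\<^sub>R) (1 / pi)"] integral_cong) (simp add: the_inv_into_shift_eq)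

lemma kato_operator_of_quasi_symmetric:
  assumes "quasi_symmetric (form_dom j a) (form_op j a)"
  shows "kato_operator j (form_dom j a) (form_op j a)"
proof -
  obtain \<alpha> \<beta> M :: real where qs: "\<alpha> > -1" "\<beta> \<ge> 0" "M \<ge> 0"
    "\<And>x. Re (cinner (adj.R 0 (x + M *\<^sub>R R 0 x)) (R 0 x)) \<ge> \<alpha> * (norm (R 0 x))\<^sup>2"
    "\<And>x. norm (adj.R 0 x) \<le> \<beta> * norm (R 0 x)"
    using assms unfolding quasi_symmetric_def
    by (auto simp: form_dom_eq form_op_R adjoint_inv_eq[unfolded form_dom_eq])
  obtain K where K: "K > 0" "\<And>p x. j p = F 0 x \<Longrightarrow> norm p \<le> K * norm x \<and> norm x \<le> K * norm p"
    "range (F 0) = range j"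
    by (rule quasi_symmetric_F_0[OF qs(1,3,2)]) (use qs(4,5) in \<open>auto simp: inner_eq_Re_cinner\<close>)
  define P where "P = inv_sqrt_op (form_dom j a) (form_op j a)"
  have P: "P x = F 0 ((1 / pi) *\<^sub>R x)" for x
    by (simp add: P_def inv_sqrt_op_eq F_scaleR)
  have P_pi: "P (pi *\<^sub>R x) = F 0 x" for x by (simp add: P)
  have "inj P"
  proof (rule injI)
    fix x y assume "P x = P y"
    then have "F 0 ((1 / pi) *\<^sub>R (x - y)) = 0" by (simp add: P F_diff scaleR_diff_right)
    \<comment> \<open>The lower norm bound with p = 0.\<close>
    then have "norm ((1 / pi) *\<^sub>R (x - y)) \<le> 0"
      using K(2)[of 0 "(1 / pi) *\<^sub>R (x - y)"] by (simp add: j.zero)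
    then show "x = y" by (simp only: norm_le_zero_iff) simp
  qed
  have "range P = range (F 0)"
  proof (intro equalityI image_subsetI)
    show "P x \<in> range (F 0)" for x unfolding P by (rule rangeI)
    show "F 0 x \<in> range P" for x unfolding P_pi[symmetric] by (rule rangeI)
  qed
  then have dom: "sqrt_dom (form_dom j a) (form_op j a) = range j"
    using K(3) by (simp add: sqrt_dom_def P_def)
  have bounds: "pi / K * norm v \<le> norm (sqrt_op (form_dom j a) (form_op j a) (j v))"
    "norm (sqrt_op (form_dom j a) (form_op j a) (j v)) \<le> pi * K * norm v" for v
  proof -
    obtain x where x: "F 0 x = j v" using K(3) by (metis rangeE rangeI)
    \<comment> \<open>The factor \<pi> undoes the normalisation of \<open>F 0\<close> and accounts
      for the constants \<open>pi / K\<close> and \<open>pi * K\<close>.\<close>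
    have "sqrt_op (form_dom j a) (form_op j a) (j v) = pi *\<^sub>R x"
      unfolding sqrt_op_def P_def[symmetric] x[symmetric] P_pi[symmetric]
      by (rule the_inv_f_f[OF \<open>inj P\<close>])
    then show "pi / K * norm v \<le> norm (sqrt_op (form_dom j a) (form_op j a) (j v))"
      "norm (sqrt_op (form_dom j a) (form_op j a) (j v)) \<le> pi * K * norm v"
      using K(1) K(2)[OF x[symmetric]] by (auto simp: field_simps)
  qed
  show ?thesis
    unfolding kato_operator_def
    by (intro conjI dom exI[of _ "pi / K"] exI[of _ "pi * K"] allI bounds) (use K(1) in auto)
qed

end

theorem theoremA5:
  fixes j :: "'v::complex_banach \<Rightarrow> 'h::complex_hilbert"
    and a :: "'v \<Rightarrow> 'v \<Rightarrow> complex"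
  assumes "dense_embedding j"
    and "sesquilinear a"
    and "continuous_form a"
    and "strongly_accretive a"
    and "quasi_symmetric (form_dom j a) (form_op j a)"
  shows "kato_operator j (form_dom j a) (form_op j a)"
  using assms by (rule kato_operator_of_quasi_symmetric)

end
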